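(* Let the boundary matrix at site $N$ be $K_-(\lambda)=e^{(\eta/2-\lambda)\sigma^z}$. For any spectral parameters $\lambda_1,\dots,\lambda_M$ and any gauge parameters $z,y$, and for any choice of the gauge parameter $x$, $$\underline{\widehat{\mathcal B}}_{-,M}(\{\lambda_i\}_{i=1}^M|z+1)\,|\eta,y\rangle=h_M(x,z,y)\sum_{\sigma_1=\pm,\dots,\sigma_M=\pm}H_{\sigma_1,\dots,\sigma_M}(\{\lambda_i\}_{i=1}^M)\ \underline B_M(\{\sigma_i\lambda_i\}_{i=1}^M|x-1,z)\,|\eta,y+M\rangle,$$ where, with $\lambda_j^{(\sigma)}=\sigma_j\lambda_j$, $$H_{\sigma_1,\dots,\sigma_M}(\{\lambda_i\}_{i=1}^M)=\prod_{j=1}^M\Big[\sigma_j\,a(-\lambda_j^{(\sigma)})\frac{\sinh(2\lambda_j-\eta)}{\sinh(2\lambda_j)}\Big]\prod_{1\le i<j\le M}\frac{\sinh(\lambda_i^{(\sigma)}+\lambda_j^{(\sigma)}+\eta)}{\sinh(\lambda_i^{(\sigma)}+\lambda_j^{(\sigma)})},$$ $$h_M(x,z,y)=(-1)^{MN}e^{M\eta\frac{x+z+N}2}\prod_{j=1}^M\frac{\sinh(\eta\frac{z-y+2j+N-1}2)}{2\sinh(\eta\frac{y-x+2j}2)}.$$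
   Context: $N\ge1$, $\sinh\eta\ne0$, $\xi_1,\dots,\xi_N\in\mathbb C$, $\mathcal H=\otimes_{n=1}^N\mathbb C^2$; parameters are such that no denominator vanishes. $a(\lambda)=\prod_n\sinh(\lambda-\xi_n+\eta/2)$. Boundary operators: $R(\lambda)$ is the 6-vertex matrix with (basis $++,+-,-+,--$) diagonal $(\sinh(\lambda+\eta),\sinh\lambda,\sinh\lambda,\sinh(\lambda+\eta))$, entries $(+-,-+)$, $(-+,+-)$ equal to $\sinh\eta$, zeros elsewhere. $T_0(\lambda)=R_{01}(\lambda-\xi_1-\eta/2)\cdots R_{0N}(\lambda-\xi_N-\eta/2)$, $\hat T_0(\lambda)=R_{0N}(\lambda+\xi_N-\eta/2)\cdots R_{01}(\lambda+\xi_1-\eta/2)$, $\mathcal U_-(\lambda)=T_0(\lambda)K_{-,0}(\lambda)\hat T_0(\lambda)=\begin{pmatrix}\mathcal A_-&\mathcal B_-\\\mathcal C_-&\mathcal D_-\end{pmatrix}(\lambda)$, $\widehat{\mathcal B}_-(\lambda|z)=\frac12[e^{-\eta z}\mathcal C_-(\lambda)-e^{\eta z}\mathcal B_-(\lambda)+e^{\eta/2-\lambda}\mathcal D_-(\lambda)-e^{\lambda-\eta/2}\mathcal A_-(\lambda)]$, $\underline{\widehat{\mathcal B}}_{-,M}(\{\lambda_i\}_{i=1}^M|z+1)=\widehat{\mathcal B}_-(\lambda_1|z+1)\widehat{\mathcal B}_-(\lambda_2|z+3)\cdots\widehat{\mathcal B}_-(\lambda_M|z+2M-1)$. Bulk operators: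 $\bar R(\lambda)=-R(-\lambda)$, $M_0(\lambda)=\bar R_{0N}(\lambda-\xi_N+\eta/2)\cdots\bar R_{01}(\lambda-\xi_1+\eta/2)=\begin{pmatrix}A&B\\C&D\end{pmatrix}(\lambda)$, $B(\lambda|x,y)=-e^{\lambda}[B(\lambda)+A(\lambda)e^{-\lambda-\eta/2-\eta y}-C(\lambda)e^{-2\lambda-\eta-\eta(x+y)}-D(\lambda)e^{-\lambda-\eta/2-\eta x}]$, $\underline B_M(\{\mu_i\}_{i=1}^M|x-1,z)=B(\mu_1|x-1,z)B(\mu_2|x-2,z+1)\cdots B(\mu_M|x-M,z+M-1)$. Reference states: $|\eta,y\rangle=\otimes_{n=1}^N\binom{e^{-(n-N+y)\eta-\xi_n}}{1}_n$. *)

theory Defs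
  imports Complex_Main "HOL-Library.FuncSet" "Jordan_Normal_Form.Matrix"
begin

text \<open>
  Spin chains with \<open>L\<close> sites numbered \<open>0, \<dots>, L - 1\<close> are modelled on vectors of dimension \<open>2 ^ L\<close>.
  A basis index \<open>k < 2 ^ L\<close> stands for the tensor product of basis vectors whose factor at site \<open>i\<close>
  is the \<open>i\<close>-th binary digit of \<open>k\<close>, where digit 0 is the state \<open>+\<close> and digit 1 is the state \<open>-\<close>.

  The auxiliary space together with the quantum sites \<open>1, \<dots>, N\<close> is a chain with \<open>N + 1\<close> sites,
  the auxiliary space being site 0.  The quantum space alone has dimension \<open>2 ^ N\<close>, and there the
  quantum site \<open>n\<close> is the digit \<open>n - 1\<close>.
\<close>

definition site_digit :: "nat \<Rightarrow> nat \<Rightarrow> nat" where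
  "site_digit k i = k div 2 ^ i mod 2"

definition site_op1 :: "nat \<Rightarrow> nat \<Rightarrow> complex mat \<Rightarrow> complex mat" where
  "site_op1 L i K = mat (2 ^ L) (2 ^ L) (\<lambda>(k, l).
     if \<forall>m<L. m \<noteq> i \<longrightarrow> site_digit k m = site_digit l m
     then K $$ (site_digit k i, site_digit l i) else 0)"

text \<open>The action of a \<open>4 \<times> 4\<close> matrix, in the basis \<open>++, +-, -+, --\<close>, on the sites \<open>i\<close> and \<open>j\<close>.\<close>

definition site_op2 :: "nat \<Rightarrow> nat \<Rightarrow> nat \<Rightarrow> complex mat \<Rightarrow> complex mat" where
  "site_op2 L i j R = mat (2 ^ L) (2 ^ L) (\<lambda>(k, l).
     if \<forall>m<L. m \<noteq> i \<and> m \<noteq> j \<longrightarrow> site_digit k m = site_digit l m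
     then R $$ (2 * site_digit k i + site_digit k j, 2 * site_digit l i + site_digit l j) else 0)"

definition mat_list_prod :: "nat \<Rightarrow> complex mat list \<Rightarrow> complex mat" where
  "mat_list_prod d Xs = foldr (*) Xs (1\<^sub>m d)"

text \<open>The operator entry \<open>(a, b)\<close> of a \<open>2 \<times> 2\<close> block matrix over the auxiliary space.\<close>

definition aux_entry :: "nat \<Rightarrow> nat \<Rightarrow> nat \<Rightarrow> complex mat \<Rightarrow> complex mat" where
  "aux_entry N a b X = mat (2 ^ N) (2 ^ N) (\<lambda>(k, l). X $$ (2 * k + a, 2 * l + b))"

definition R_mat :: "complex \<Rightarrow> complex \<Rightarrow> complex mat" where
  "R_mat \<eta> u = mat_of_rows_list 4
     [[sinh (u + \<eta>), 0, 0, 0],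
      [0, sinh u, sinh \<eta>, 0],
      [0, sinh \<eta>, sinh u, 0],
      [0, 0, 0, sinh (u + \<eta>)]]"

definition R_bar_mat :: "complex \<Rightarrow> complex \<Rightarrow> complex mat" where
  "R_bar_mat \<eta> u = - R_mat \<eta> (- u)"

definition sigma_z :: "complex mat" where
  "sigma_z = mat_of_rows_list 2 [[1, 0], [0, -1]]"

definition mat_exp :: "complex mat \<Rightarrow> complex mat" where
  "mat_exp X = mat (dim_row X) (dim_row X) (\<lambda>(i, j). \<Sum>k. (X ^\<^sub>m k) $$ (i, j) / fact k)"

definition K_minus :: "complex \<Rightarrow> complex \<Rightarrow> complex mat" where
  "K_minus \<eta> u = mat_exp ((\<eta> / 2 - u) \<cdot>\<^sub>m sigma_z)"

lemma K_minus_diag: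
  "K_minus \<eta> u = mat_of_rows_list 2 [[exp (\<eta> / 2 - u), 0], [0, exp (u - \<eta> / 2)]]"
proof -
  define c where "c = \<eta> / 2 - u"
  define d where "d i = (if i = (0::nat) then c else - c)" for i
  define X where "X = mat 2 2 (\<lambda>(i, j). if i = j then d i else 0)"
  have X: "c \<cdot>\<^sub>m sigma_z = X"
    by (rule eq_matI)
      (auto simp: X_def d_def sigma_z_def mat_of_rows_list_def less_2_cases_iff)
  have dX: "dim_row X = 2" "dim_col X = 2"
    by (simp_all add: X_def)
  have pow: "X ^\<^sub>m k = mat 2 2 (\<lambda>(i, j). if i = j then d i ^ k else 0)" for k
  proof (induction k)
    case 0
    show ?case by (rule eq_matI) (auto simp: dX)
  next
    case (Suc k)
    show ?case
    proof (rule eq_matI)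
      fix i j
      assume "i < dim_row (mat 2 2 (\<lambda>(i, j). if i = j then d i ^ Suc k else 0))"
        and "j < dim_col (mat 2 2 (\<lambda>(i, j). if i = j then d i ^ Suc k else 0))"
      then have ij: "i < 2" "j < 2" by simp_all
      have "(X ^\<^sub>m Suc k) $$ (i, j) =
          (\<Sum>m\<in>{0..<2}. (if i = m then d i ^ k else 0) * (if m = j then d m else 0))"
        unfolding pow_mat.simps(2) Suc using ij by (simp add: X_def scalar_prod_def)
      also have "\<dots> = (if i = j then d i ^ Suc k else 0)"
        using ij by (simp add: if_distrib [of "\<lambda>t. t * _"] sum.delta cong: if_cong)
      finally show "(X ^\<^sub>m Suc k) $$ (i, j) =
          mat 2 2 (\<lambda>(i, j). if i = j then d i ^ Suc k else 0) $$ (i, j)"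
        using ij by simp
    qed (simp_all add: Suc dX)
  qed
  have ex: "(\<Sum>k. w ^ k / fact k) = exp w" for w :: complex
    by (simp add: exp_def scaleR_conv_of_real field_simps)
  have "mat_exp X $$ (i, j) = (if i = j then exp (d i) else 0)" if "i < 2" "j < 2" for i j
    using that by (simp add: mat_exp_def dX pow ex)
  moreover have "dim_row (mat_exp X) = 2" "dim_col (mat_exp X) = 2"
    by (simp_all add: mat_exp_def dX)
  ultimately have "mat_exp X = mat_of_rows_list 2 [[exp c, 0], [0, exp (- c)]]"
    by (intro eq_matI) (auto simp: mat_of_rows_list_def d_def less_Suc_eq dest!: less_2_cases)
  then show ?thesis
    unfolding K_minus_def c_def [symmetric] X by (simp add: c_def)
qed

definition monodromy_T :: "nat \<Rightarrow> complex \<Rightarrow> (nat \<Rightarrow> complex) \<Rightarrow> complex \<Rightarrow> complex mat" where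
  "monodromy_T N \<eta> \<xi> u = mat_list_prod (2 ^ (N + 1))
     (map (\<lambda>n. site_op2 (N + 1) 0 n (R_mat \<eta> (u - \<xi> n - \<eta> / 2))) [1..<N + 1])"

definition monodromy_T_hat :: "nat \<Rightarrow> complex \<Rightarrow> (nat \<Rightarrow> complex) \<Rightarrow> complex \<Rightarrow> complex mat" where
  "monodromy_T_hat N \<eta> \<xi> u = mat_list_prod (2 ^ (N + 1))
     (map (\<lambda>n. site_op2 (N + 1) 0 n (R_mat \<eta> (u + \<xi> n - \<eta> / 2))) (rev [1..<N + 1]))"

definition U_minus :: "nat \<Rightarrow> complex \<Rightarrow> (nat \<Rightarrow> complex) \<Rightarrow> complex \<Rightarrow> complex mat" where
  "U_minus N \<eta> \<xi> u =
     monodromy_T N \<eta> \<xi> u * site_op1 (N + 1) 0 (K_minus \<eta> u) * monodromy_T_hat N \<eta> \<xi> u"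

definition B_hat :: "nat \<Rightarrow> complex \<Rightarrow> (nat \<Rightarrow> complex) \<Rightarrow> complex \<Rightarrow> complex \<Rightarrow> complex mat" where
  "B_hat N \<eta> \<xi> u z =
     (let U = U_minus N \<eta> \<xi> u;
          \<A> = aux_entry N 0 0 U; \<B> = aux_entry N 0 1 U;
          \<C> = aux_entry N 1 0 U; \<D> = aux_entry N 1 1 U
      in (1 / 2) \<cdot>\<^sub>m (exp (- \<eta> * z) \<cdot>\<^sub>m \<C> - exp (\<eta> * z) \<cdot>\<^sub>m \<B>
           + exp (\<eta> / 2 - u) \<cdot>\<^sub>m \<D> - exp (u - \<eta> / 2) \<cdot>\<^sub>m \<A>))"

text \<open>\<open>B_hat_prod \<dots> w\<close> has the gauge parameters \<open>w, w + 2, \<dots>, w + 2 * M - 2\<close>.\<close>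

definition B_hat_prod ::
  "nat \<Rightarrow> complex \<Rightarrow> (nat \<Rightarrow> complex) \<Rightarrow> nat \<Rightarrow> (nat \<Rightarrow> complex) \<Rightarrow> complex \<Rightarrow> complex mat" where
  "B_hat_prod N \<eta> \<xi> M \<mu> w = mat_list_prod (2 ^ N)
     (map (\<lambda>j. B_hat N \<eta> \<xi> (\<mu> j) (w + 2 * (of_nat j - 1))) [1..<M + 1])"

definition monodromy_M :: "nat \<Rightarrow> complex \<Rightarrow> (nat \<Rightarrow> complex) \<Rightarrow> complex \<Rightarrow> complex mat" where
  "monodromy_M N \<eta> \<xi> u = mat_list_prod (2 ^ (N + 1))
     (map (\<lambda>n. site_op2 (N + 1) 0 n (R_bar_mat \<eta> (u - \<xi> n + \<eta> / 2))) (rev [1..<N + 1]))"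

definition B_bulk ::
  "nat \<Rightarrow> complex \<Rightarrow> (nat \<Rightarrow> complex) \<Rightarrow> complex \<Rightarrow> complex \<Rightarrow> complex \<Rightarrow> complex mat" where
  "B_bulk N \<eta> \<xi> u x y =
     (let X = monodromy_M N \<eta> \<xi> u;
          A = aux_entry N 0 0 X; B = aux_entry N 0 1 X;
          C = aux_entry N 1 0 X; D = aux_entry N 1 1 X
      in (- exp u) \<cdot>\<^sub>m (B + exp (- u - \<eta> / 2 - \<eta> * y) \<cdot>\<^sub>m A
           - exp (- 2 * u - \<eta> - \<eta> * (x + y)) \<cdot>\<^sub>m C
           - exp (- u - \<eta> / 2 - \<eta> * x) \<cdot>\<^sub>m D))"

text \<open>
  \<open>B_bulk_prod \<dots> w z\<close> has the pairs of gauge parameters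
  \<open>(w, z), (w - 1, z + 1), \<dots>, (w - M + 1, z + M - 1)\<close>.
\<close>

definition B_bulk_prod ::
  "nat \<Rightarrow> complex \<Rightarrow> (nat \<Rightarrow> complex) \<Rightarrow> nat \<Rightarrow> (nat \<Rightarrow> complex) \<Rightarrow> complex \<Rightarrow> complex \<Rightarrow> complex mat"
where
  "B_bulk_prod N \<eta> \<xi> M \<mu> w z = mat_list_prod (2 ^ N)
     (map (\<lambda>j. B_bulk N \<eta> \<xi> (\<mu> j) (w - (of_nat j - 1)) (z + (of_nat j - 1))) [1..<M + 1])"

definition ref_state :: "nat \<Rightarrow> complex \<Rightarrow> (nat \<Rightarrow> complex) \<Rightarrow> complex \<Rightarrow> complex vec" where
  "ref_state N \<eta> \<xi> y = vec (2 ^ N) (\<lambda>k. \<Prod>n\<in>{1..N}.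
     if site_digit k (n - 1) = 0 then exp (- (of_nat n - of_nat N + y) * \<eta> - \<xi> n) else 1)"

definition a_fun :: "nat \<Rightarrow> complex \<Rightarrow> (nat \<Rightarrow> complex) \<Rightarrow> complex \<Rightarrow> complex" where
  "a_fun N \<eta> \<xi> u = (\<Prod>n\<in>{1..N}. sinh (u - \<xi> n + \<eta> / 2))"

definition H_coeff ::
  "nat \<Rightarrow> complex \<Rightarrow> (nat \<Rightarrow> complex) \<Rightarrow> nat \<Rightarrow> (nat \<Rightarrow> complex) \<Rightarrow> (nat \<Rightarrow> complex) \<Rightarrow> complex" where
  "H_coeff N \<eta> \<xi> M \<sigma> \<mu> =
     (\<Prod>j\<in>{1..M}. \<sigma> j * a_fun N \<eta> \<xi> (- (\<sigma> j * \<mu> j)) * (sinh (2 * \<mu> j - \<eta>) / sinh (2 * \<mu> j))) *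
     (\<Prod>j\<in>{1..M}. \<Prod>i\<in>{1..<j}.
        sinh (\<sigma> i * \<mu> i + \<sigma> j * \<mu> j + \<eta>) / sinh (\<sigma> i * \<mu> i + \<sigma> j * \<mu> j))"

definition h_coeff :: "nat \<Rightarrow> complex \<Rightarrow> nat \<Rightarrow> complex \<Rightarrow> complex \<Rightarrow> complex \<Rightarrow> complex" where
  "h_coeff N \<eta> M x z y =
     (- 1) ^ (M * N) * exp (of_nat M * \<eta> * ((x + z + of_nat N) / 2)) *
     (\<Prod>j\<in>{1..M}. sinh (\<eta> * ((z - y + 2 * of_nat j + of_nat N - 1) / 2)) /
        (2 * sinh (\<eta> * ((y - x + 2 * of_nat j) / 2))))"

end

(*
  Gauge-transformed entries of the bulk monodromy matrix are built from its columns contracted with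
  the vector (q, e^u).  For two consecutive gauge parameters q, q e^{-eta} such a pair of columns is
  symmetric under the R-matrix, which yields the exchange relations of the dynamical Yang-Baxter
  algebra.  By crossing, T(u) is the transposed comatrix of the bulk monodromy matrix at u and
  T^(u) is, up to sign, the bulk monodromy matrix at -u, and for the boundary matrix at hand the
  gauged boundary operator becomes the antisymmetrisation in u of a product B(u) D(-u) of
  gauged bulk operators, where the gauge parameter of D is free.  It is chosen such that the
  reference state is an eigenvector (up to a shift of its gauge parameter) of D after D has been
  moved to the right through all the B operators.  Induction on the number of operators then
  leaves the claimed terms and "unwanted" terms, which cancel when summed over the signs: the
  weight of the term in which u_j is absorbed by D is odd in u_j.
*)

theory Submission
  imports Defs
begin

text \<open>Why the row parameters p of B and s of D stay free: under the exchange of u and -u the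
  products of two gauged columns with equal spins are symmetric (up to a factor sinh (2u - \<eta>)
  that is carried along). Antisymmetrisation therefore leaves only the two mixed products, in the
  ratio e^u : -e^(\<eta> - u) for every p and s, and this is exactly the ratio that the exponentials
  of the given boundary matrix produce. p becomes the arbitrary x, whereas s is tied to y. One s
  serves all stages of the induction: moving D through k operators multiplies s by e^(-k \<eta>),
  and the k boundary operators already applied have lowered the reference state by the same factor.
  The obstacle is that the dynamical coefficients of the unwanted terms have no parity in u_j. They
  are therefore written as E + D coth (v - u_j) with E and D independent of v, where v = l or v = -l
  is the parameter of the moved operator. E cancels between the two values of v, and coth (-l - u_j)
  - coth (l - u_j) is even in u_j, so it does not disturb the odd weight.\<close>

(* Configurations have infinitely many sites, so that the operators of chains of all lengths act on
   the same space; False is the digit 0, i.e. the spin +. *)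
type_synonym state = "(nat \<Rightarrow> bool) \<Rightarrow> complex"

abbreviation (input) ratio_minus :: "complex \<Rightarrow> complex \<Rightarrow> complex" where
  "ratio_minus \<eta> w \<equiv> sinh (w - \<eta>) / sinh w"

abbreviation (input) ratio_plus :: "complex \<Rightarrow> complex \<Rightarrow> complex" where
  "ratio_plus \<eta> w \<equiv> sinh (w + \<eta>) / sinh w"

section \<open>Lax operators and the exchange of gauged columns\<close>

text \<open>The entry of \<open>R_bar_mat\<close> in row (a, s) and column (b, t), where a and b are
  spins of the auxiliary space.\<close>

definition weight :: "complex \<Rightarrow> complex \<Rightarrow> bool \<Rightarrow> bool \<Rightarrow> bool \<Rightarrow> bool \<Rightarrow> complex" where
  "weight \<eta> w a s b t =
     (if a = b \<and> s = t then (if a = s then sinh (w - \<eta>) else sinh w)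
      else if a = t \<and> s = b then - sinh \<eta> else 0)"

definition lax :: "complex \<Rightarrow> complex \<Rightarrow> nat \<Rightarrow> bool \<Rightarrow> bool \<Rightarrow> state \<Rightarrow> state" where
  "lax \<eta> w n a b f = (\<lambda>c. if a = b then (if c n = a then sinh (w - \<eta>) else sinh w) * f c
     else if c n = b then - sinh \<eta> * f (c(n := a)) else 0)"

text \<open>The matrix form of \<open>lax\<close>: it is what the action of \<open>site_op2\<close>
  on a vector produces, and continuity in w can be read off from it entry by entry.\<close>

lemma lax_weight:
  "lax \<eta> w n a b f c =
     weight \<eta> w a (c n) b False * f (c(n := False)) + weight \<eta> w a (c n) b True * f (c(n := True))"
proof -
  have "c(n := False) = c" if "\<not> c n" using that by (simp add: fun_upd_idem)
  moreover have "c(n := True) = c" if "c n" using that by (simp add: fun_upd_idem)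
  ultimately show ?thesis
    by (cases a; cases b; cases "c n") (simp_all add: lax_def weight_def)
qed

section \<open>Linear operators on states\<close>

definition linear_op :: "(state \<Rightarrow> state) \<Rightarrow> bool" where
  "linear_op T \<longleftrightarrow> (\<forall>f g. T (\<lambda>c. f c + g c) = (\<lambda>c. T f c + T g c)) \<and>
     (\<forall>k f. T (\<lambda>c. k * f c) = (\<lambda>c. k * T f c))"

lemma linear_op_add: "linear_op T \<Longrightarrow> T (\<lambda>c. f c + g c) = (\<lambda>c. T f c + T g c)"
  and linear_op_scale: "linear_op T \<Longrightarrow> T (\<lambda>c. k * f c) = (\<lambda>c. k * T f c)"
  by (simp_all add: linear_op_def)

lemma linear_op_diff:
  assumes "linear_op T" shows "T (\<lambda>c. f c - g c) = (\<lambda>c. T f c - T g c)"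
  using linear_op_add [OF assms, of f "\<lambda>c. (-1) * g c"] linear_op_scale [OF assms, of "-1" g]
  by simp

lemma linear_op_sum:
  assumes "linear_op T"
  shows "T (\<lambda>c. \<Sum>i\<in>I. f i c) = (\<lambda>c. \<Sum>i\<in>I. T (f i) c)"
proof -
  have "T (\<lambda>c. 0) = (\<lambda>c. 0)"
    using linear_op_scale [OF assms, of 0 "\<lambda>c. 0"] by simp
  then show ?thesis
    by (induction I rule: infinite_finite_induct) (simp_all add: linear_op_add [OF assms])
qed

lemma linear_lax: "linear_op (lax \<eta> w n a b)"
  by (auto simp: linear_op_def lax_def fun_eq_iff algebra_simps)

lemma lax_commute:
  "n \<noteq> m \<Longrightarrow> lax \<eta> w n a b (lax \<eta> v m d e f) = lax \<eta> v m d e (lax \<eta> w n a b f)"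
  by (auto simp: lax_def fun_eq_iff fun_upd_twist)

text \<open>These two expansions are what makes the vector (q, e^u) and the covector (p e^(-u), -1)
  compatible with the R-matrix.\<close>

lemma sinh_diff_exp:
  fixes w \<eta> :: complex
  shows "sinh (w - \<eta>) = exp \<eta> * sinh w - exp w * sinh \<eta>"
    and "sinh (w - \<eta>) = exp (- \<eta>) * sinh w - exp (- w) * sinh \<eta>"
  by (simp_all add: sinh_field_def exp_diff exp_minus field_simps)

text \<open>The Yang-Baxter equation at one site. Only the spin at site n enters besides the four
  auxiliary spins, which leaves 32 identities between exponentials.\<close>

lemma RLL:
  assumes "w - v = u"
  shows "(\<Sum>d\<in>UNIV. \<Sum>e\<in>UNIV. weight \<eta> u a b d e * lax \<eta> w n d a' (lax \<eta> v n e b' f) c) =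
    (\<Sum>d\<in>UNIV. \<Sum>e\<in>UNIV. weight \<eta> u d e a' b' * lax \<eta> v n b e (lax \<eta> w n a d f) c)"
proof -
  have w: "w = u + v" by (simp flip: assms)
  have x: "sinh x = (exp x - inverse (exp x)) / 2" for x :: complex
    by (simp add: sinh_field_def exp_minus)
  have upd: "c(n := True) = c" if "c n" using that by (simp add: fun_upd_idem)
  have upd': "c(n := False) = c" if "\<not> c n" using that by (simp add: fun_upd_idem)
  show ?thesis
    apply (cases a; cases b; cases a'; cases b'; cases "c n")
    apply (simp_all add: UNIV_bool weight_def lax_def upd upd' w)
    apply (simp_all add: x exp_diff exp_add field_simps)
    done
qed

context
  fixes \<eta> :: complex and \<xi> :: "nat \<Rightarrow> complex"
begin

primrec monodromy_act :: "nat \<Rightarrow> complex \<Rightarrow> (bool \<Rightarrow> state) \<Rightarrow> bool \<Rightarrow> state" where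
  "monodromy_act 0 u G = G"
| "monodromy_act (Suc N) u G =
     (\<lambda>a c. \<Sum>b\<in>UNIV. lax \<eta> (u - \<xi> (Suc N) + \<eta> / 2) N a b (monodromy_act N u G b) c)"

(* With q = exp (- \<eta> / 2 - \<eta> * y) this is the column (A, C) q + e^u (B, D) of the monodromy matrix. *)
definition gauge_col :: "nat \<Rightarrow> complex \<Rightarrow> complex \<Rightarrow> bool \<Rightarrow> state \<Rightarrow> state" where
  "gauge_col N q u a f = monodromy_act N u (\<lambda>b c. (if b then exp u else q) * f c) a"

lemma gauge_col_0: "gauge_col 0 q u a f = (\<lambda>c. (if a then exp u else q) * f c)"
  by (simp add: gauge_col_def)

lemma gauge_col_Suc: "gauge_col (Suc N) q u a f =
   (\<lambda>c. \<Sum>b\<in>UNIV. lax \<eta> (u - \<xi> (Suc N) + \<eta> / 2) N a b (gauge_col N q u b f) c)"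
  by (simp add: gauge_col_def)

lemma linear_gauge_col: "linear_op (gauge_col N q u a)"
proof (induction N arbitrary: a)
  case 0
  show ?case by (auto simp: linear_op_def gauge_col_0 fun_eq_iff algebra_simps)
next
  case (Suc N)
  have "gauge_col N q u a (\<lambda>c. f c + g c) = (\<lambda>c. gauge_col N q u a f c + gauge_col N q u a g c)"
    "gauge_col N q u a (\<lambda>c. k * f c) = (\<lambda>c. k * gauge_col N q u a f c)" for a f g k
    using Suc by (simp_all add: linear_op_def)
  then show ?case
    unfolding linear_op_def gauge_col_Suc
    by (simp add: linear_op_add [OF linear_lax] linear_op_scale [OF linear_lax] UNIV_bool
        algebra_simps)
qed

text \<open>The column acts on the sites below N only. This allows the Lax operators of a new last
  site to be pulled out of a product of two columns.\<close>

lemma gauge_col_lax_commute: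
  "N \<le> n \<Longrightarrow> gauge_col N q u a (lax \<eta> w n b e f) = lax \<eta> w n b e (gauge_col N q u a f)"
proof (induction N arbitrary: a)
  case 0
  show ?case by (auto simp: gauge_col_0 lax_def fun_eq_iff)
next
  case (Suc N)
  then have "gauge_col N q u a (lax \<eta> w n b e f) = lax \<eta> w n b e (gauge_col N q u a f)" for a
    by simp
  moreover have "lax \<eta> v N a d (lax \<eta> w n b e g) = lax \<eta> w n b e (lax \<eta> v N a d g)" for v d g
    using Suc.prems by (intro lax_commute) simp
  ultimately show ?case
    by (auto simp: gauge_col_Suc UNIV_bool linear_op_add [OF linear_lax])
qed

text \<open>(q, e^u) and (q e^(-\<eta>), e^v) are intertwining vectors: on their tensor product R
  exchanges u and v up to a scalar, while q and q e^(-\<eta>) keep their places. This is the chain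
  without sites, and \<open>RLL\<close> carries it through one site at a time.\<close>

lemma gauge_col_exchange:
  "(\<Sum>d\<in>UNIV. \<Sum>e\<in>UNIV. weight \<eta> (u - v) a b d e *
       gauge_col N q u d (gauge_col N (q * exp (- \<eta>)) v e f) c) =
     sinh (u - v - \<eta>) * gauge_col N q v b (gauge_col N (q * exp (- \<eta>)) u a f) c"
proof (induction N arbitrary: a b c)
  case 0
  have x: "sinh x = (exp x - inverse (exp x)) / 2" for x :: complex
    by (simp add: sinh_field_def exp_minus)
  show ?case
    by (cases a; cases b; simp add: UNIV_bool weight_def gauge_col_0)
      (simp_all add: x exp_diff exp_add exp_minus field_simps)
next
  case (Suc N)
  define q' where "q' = q * exp (- \<eta>)"
  let ?L = "\<lambda>w. lax \<eta> (w - \<xi> (Suc N) + \<eta> / 2) N"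
  let ?x = "\<lambda>u v a b. gauge_col N q u a (gauge_col N q' v b f)"
  have comm: "gauge_col (Suc N) q u d (gauge_col (Suc N) q' v e f) c =
      (\<Sum>a'\<in>UNIV. \<Sum>b'\<in>UNIV. ?L u d a' (?L v e b' (?x u v a' b')) c)" for u v d e
    by (simp add: gauge_col_Suc UNIV_bool linear_op_add [OF linear_gauge_col]
        linear_op_add [OF linear_lax] gauge_col_lax_commute algebra_simps)
  have IH: "(\<lambda>c. \<Sum>a'\<in>UNIV. \<Sum>b'\<in>UNIV. weight \<eta> (u - v) d e a' b' * ?x u v a' b' c) =
      (\<lambda>c. sinh (u - v - \<eta>) * ?x v u e d c)" for d e
    using Suc.IH by (simp add: fun_eq_iff q'_def)
  have RLL': "(\<Sum>d\<in>UNIV. \<Sum>e\<in>UNIV. weight \<eta> (u - v) a b d e * ?L u d a' (?L v e b' g) c) =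
    (\<Sum>d\<in>UNIV. \<Sum>e\<in>UNIV. weight \<eta> (u - v) d e a' b' * ?L v b e (?L u a d g) c)" for a' b' g
    by (rule RLL) simp
  have "(\<Sum>d\<in>UNIV. \<Sum>e\<in>UNIV. weight \<eta> (u - v) a b d e *
       gauge_col (Suc N) q u d (gauge_col (Suc N) q' v e f) c) =
     (\<Sum>a'\<in>UNIV. \<Sum>b'\<in>UNIV. \<Sum>d\<in>UNIV. \<Sum>e\<in>UNIV.
        weight \<eta> (u - v) a b d e * ?L u d a' (?L v e b' (?x u v a' b')) c)"
    unfolding comm by (simp add: UNIV_bool algebra_simps)
  also have "\<dots> = (\<Sum>a'\<in>UNIV. \<Sum>b'\<in>UNIV. \<Sum>d\<in>UNIV. \<Sum>e\<in>UNIV.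
        weight \<eta> (u - v) d e a' b' * ?L v b e (?L u a d (?x u v a' b')) c)"
    unfolding RLL' ..
  also have "\<dots> = (\<Sum>d\<in>UNIV. \<Sum>e\<in>UNIV. ?L v b e (?L u a d
       (\<lambda>c. \<Sum>a'\<in>UNIV. \<Sum>b'\<in>UNIV. weight \<eta> (u - v) d e a' b' * ?x u v a' b' c)) c)"
    by (simp add: UNIV_bool linear_op_add [OF linear_lax] linear_op_scale [OF linear_lax]
        algebra_simps)
  also have "\<dots> = sinh (u - v - \<eta>) * gauge_col (Suc N) q v b (gauge_col (Suc N) q' u a f) c"
    unfolding IH comm
    by (simp add: UNIV_bool linear_op_scale [OF linear_lax] algebra_simps)
  finally show ?case unfolding q'_def .
qed

end

section \<open>Exchange relations of the gauged bulk operators\<close>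

text \<open>X and Y are the products of two columns in the orders (u, v) and (v, u), indexed by
  their spins, with a = sinh (u - v - \<eta>), b = sinh (u - v), s = sinh \<eta> and t = e^\<eta>.
  The conditions on U = e^(-u) and V = e^(-v) say that the row covectors intertwine as well.\<close>

lemma symmetric_coefficients:
  fixes a :: "complex"
  assumes "a * Y11 = a * X11" "a * Y00 = a * X00"
    and Y: "a * Y01 = b * X10 - s * X01" "a * Y10 = b * X01 - s * X10"
    and U: "t * b * U - s * V = a * U" "b * V - t * s * U = a * t * V"
  shows "a * (p * (p * t) * U * V * X11 - p * U * X10 - p * t * V * X01 + X00) =
    a * (p * (p * t) * V * U * Y11 - p * V * Y10 - p * t * U * Y01 + Y00)"
proof -
  have "a * (p * (p * t) * V * U * Y11 - p * V * Y10 - p * t * U * Y01 + Y00) =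
    p * (p * t) * V * U * (a * Y11) - p * V * (a * Y10) - p * t * U * (a * Y01) + a * Y00"
    by (simp add: algebra_simps)
  also have "\<dots> = p * (p * t) * V * U * (a * X11) - p * X10 * (t * b * U - s * V)
      - p * X01 * (b * V - t * s * U) + a * X00"
    unfolding assms(1,2) Y by (simp add: algebra_simps)
  finally show ?thesis unfolding U by (simp add: algebra_simps)
qed

text \<open>Here r is the row parameter of the diagonal operator. Y occurs only with the factor a,
  so nothing is divided by a and the resulting exchange relation also holds where a = sinh (v - u -
  \<eta>) vanishes.\<close>

lemma exchange_coefficients:
  fixes a :: "complex"
  assumes "a * Y11 = a * X11" "a * Y00 = a * X00"
    and Y: "a * Y01 = b * X10 - s * X01" "a * Y10 = b * X01 - s * X10"
    and U: "t * b * V - s * U = a * V" "b * U - t * s * V = a * t * U"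
    and t: "t * t' = 1" 
  shows "b * (p * t - r * t' * t') * (r * p * V * U * X11 - r * V * X10 - p * U * X01 + X00) =
    a * (p - r * t') * (p * t * (r * t') * U * V * Y11 - p * t * U * Y10 - r * t' * V * Y01 + Y00) +
    (b * (p * t - r * t' * t') - a * (p - r * t')) * 
    (p * t * (r * t') * V * U * X11 - p * t * V * X10 - r * t' * U * X01 + X00)"
proof -
  have "p * t * (r * t') = p * r * (t * t')" by simp
  then have tr: "p * t * (r * t') = p * r" unfolding t by simp
  have t0: "t \<noteq> 0" and t': "t' = inverse t" using t inverse_unique [OF t] by auto
  have sU: "s * U = t * b * V - a * V" unfolding U(1) [symmetric] by simp
  have "t * (t' * b * U - a * U) = (t * t') * b * U - a * t * U" by (simp add: algebra_simps)
  also have "\<dots> = t * (s * V)" unfolding t U(2) [symmetric] by simp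
  finally have sV: "s * V = t' * b * U - a * U" using t0 by simp
  have c10: "- (b * (p * t - r * t' * t') * r * V) =
    (p - r * t') * (p * t * (s * U) - r * t' * V * b) - (b * (p * t - r * t' * t') - a * (p - r * t')) * (p * t * V)"
    unfolding sU t' using t0 by (simp add: field_simps)
  have c01: "- (b * (p * t - r * t' * t') * p * U) =
    (p - r * t') * (r * t' * (s * V) - p * t * U * b) - (b * (p * t - r * t' * t') - a * (p - r * t')) * (r * t' * U)"
    unfolding sV t' using t0 by (simp add: field_simps)
  have "a * (p - r * t') * (p * t * (r * t') * U * V * Y11 - p * t * U * Y10 - r * t' * V * Y01 + Y00) +
    (b * (p * t - r * t' * t') - a * (p - r * t')) * 
    (p * t * (r * t') * V * U * X11 - p * t * V * X10 - r * t' * U * X01 + X00) =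
    (p - r * t') * (p * r * U * V * (a * Y11) - p * t * U * (a * Y10) - r * t' * V * (a * Y01) + a * Y00) +
    (b * (p * t - r * t' * t') - a * (p - r * t')) * 
    (p * r * U * V * X11 - p * t * V * X10 - r * t' * U * X01 + X00)"
    unfolding tr by (simp add: algebra_simps)
  also have "\<dots> = b * (p * t - r * t' * t') * (p * r * U * V * X11 + X00) +
     X10 * ((p - r * t') * (p * t * (s * U) - r * t' * V * b) - (b * (p * t - r * t' * t') - a * (p - r * t')) * (p * t * V))
     + X01 * ((p - r * t') * (r * t' * (s * V) - p * t * U * b) - (b * (p * t - r * t' * t') - a * (p - r * t')) * (r * t' * U))"
    unfolding assms(1,2) Y by (simp add: algebra_simps)
  finally show ?thesis 
    unfolding c10 [symmetric] c01 [symmetric]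
   by (simp add: algebra_simps)
qed
context
  fixes \<eta> :: complex and \<xi> :: "nat \<Rightarrow> complex"
begin

(* p and q stand for exp (- \<eta> / 2 - \<eta> * x) and exp (- \<eta> / 2 - \<eta> * y), so that x - 1 and y + 1
   become p * exp \<eta> and q * exp (- \<eta>).  The "diagonal operators" are gauge_B with a row parameter
   that is moved in the opposite direction. *)
definition gauge_B :: "nat \<Rightarrow> complex \<Rightarrow> complex \<Rightarrow> complex \<Rightarrow> state \<Rightarrow> state" where
  "gauge_B N p q u f =
     (\<lambda>c. p * exp (- u) * gauge_col \<eta> \<xi> N q u True f c - gauge_col \<eta> \<xi> N q u False f c)"

lemma linear_gauge_B: "linear_op (gauge_B N p q u)"
  using linear_gauge_col [of \<eta> \<xi> N q u]
  by (auto simp: linear_op_def gauge_B_def fun_eq_iff algebra_simps)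

lemma gauge_col_swap:
  fixes N q u v f c
  defines "\<Phi> \<equiv> \<lambda>u v a b. gauge_col \<eta> \<xi> N q u a (gauge_col \<eta> \<xi> N (q * exp (- \<eta>)) v b f) c"
  shows "sinh (u - v - \<eta>) * \<Phi> v u a a = sinh (u - v - \<eta>) * \<Phi> u v a a"
    and "sinh (u - v - \<eta>) * \<Phi> v u False True =
      sinh (u - v) * \<Phi> u v True False - sinh \<eta> * \<Phi> u v False True"
    and "sinh (u - v - \<eta>) * \<Phi> v u True False =
      sinh (u - v) * \<Phi> u v False True - sinh \<eta> * \<Phi> u v True False"
proof -
  have ex: "(\<Sum>d\<in>UNIV. \<Sum>e\<in>UNIV. weight \<eta> (u - v) a b d e * \<Phi> u v d e) =
      sinh (u - v - \<eta>) * \<Phi> v u b a" for a b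
    unfolding \<Phi>_def by (rule gauge_col_exchange)
  show "sinh (u - v - \<eta>) * \<Phi> v u a a = sinh (u - v - \<eta>) * \<Phi> u v a a"
    using ex [of a a, symmetric] by (cases a) (simp_all add: UNIV_bool weight_def)
  show "sinh (u - v - \<eta>) * \<Phi> v u False True =
      sinh (u - v) * \<Phi> u v True False - sinh \<eta> * \<Phi> u v False True"
    using ex [of True False] by (simp add: UNIV_bool weight_def)
  show "sinh (u - v - \<eta>) * \<Phi> v u True False =
      sinh (u - v) * \<Phi> u v False True - sinh \<eta> * \<Phi> u v True False"
    using ex [of False True] by (simp add: UNIV_bool weight_def)
qed

lemma gauge_B_gauge_B:
  "gauge_B N p q u (gauge_B N p' q' v f) c =
    p * p' * exp (- u) * exp (- v) * gauge_col \<eta> \<xi> N q u True (gauge_col \<eta> \<xi> N q' v True f) c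
    - p * exp (- u) * gauge_col \<eta> \<xi> N q u True (gauge_col \<eta> \<xi> N q' v False f) c
    - p' * exp (- v) * gauge_col \<eta> \<xi> N q u False (gauge_col \<eta> \<xi> N q' v True f) c
    + gauge_col \<eta> \<xi> N q u False (gauge_col \<eta> \<xi> N q' v False f) c"
  unfolding gauge_B_def
  by (simp add: linear_op_diff [OF linear_gauge_col] linear_op_scale [OF linear_gauge_col]
      algebra_simps)

lemma gauge_B_symmetric_generic:
  assumes "sinh (u - v - \<eta>) \<noteq> 0"
  shows "gauge_B N p q u (gauge_B N (p * exp \<eta>) (q * exp (- \<eta>)) v f) c =
    gauge_B N p q v (gauge_B N (p * exp \<eta>) (q * exp (- \<eta>)) u f) c"
proof -
  note sw = gauge_col_swap [where N = N and q = q and u = u and v = v and f = f and c = c]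
  have "exp \<eta> * sinh (u - v) * exp (- u) - sinh \<eta> * exp (- v) = sinh (u - v - \<eta>) * exp (- u)"
    unfolding sinh_diff_exp(1) by (simp add: exp_diff exp_minus field_simps)
  moreover have "sinh (u - v) * exp (- v) - exp \<eta> * sinh \<eta> * exp (- u) =
      sinh (u - v - \<eta>) * exp \<eta> * exp (- v)"
    unfolding sinh_diff_exp(2) by (simp add: exp_diff exp_minus field_simps)
  ultimately have "sinh (u - v - \<eta>) * gauge_B N p q u (gauge_B N (p * exp \<eta>) (q * exp (- \<eta>)) v f) c =
    sinh (u - v - \<eta>) * gauge_B N p q v (gauge_B N (p * exp \<eta>) (q * exp (- \<eta>)) u f) c"
    unfolding gauge_B_gauge_B by (rule symmetric_coefficients [OF sw(1) sw(1) sw(2,3)])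
  then show ?thesis using assms by simp
qed

section \<open>Continuity in the spectral parameter\<close>

lemma isCont_weight:
  fixes h :: "complex \<Rightarrow> complex"
  assumes "isCont h u"
  shows "isCont (\<lambda>u. weight \<eta> (h u) a s b d) u"
proof (cases "a = b \<and> s = d")
  case eq: True
  show ?thesis
  proof (cases "a = s")
    case True
    have w: "weight \<eta> w a s b d = sinh (w - \<eta>)" for w
      unfolding weight_def if_P [OF eq] if_P [OF True] ..
    show ?thesis
      unfolding w by (rule continuous_sinh [OF continuous_diff [OF assms continuous_const]])
  next
    case False
    have w: "weight \<eta> w a s b d = sinh w" for w
      unfolding weight_def if_P [OF eq] if_not_P [OF False] ..
    show ?thesis unfolding w by (rule continuous_sinh [OF assms])
  qed
next
  case False
  have w: "weight \<eta> w a s b d = (if a = d \<and> s = b then - sinh \<eta> else 0)" for w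
    unfolding weight_def using False by (rule if_not_P)
  show ?thesis unfolding w by (rule continuous_const)
qed

lemma isCont_gauge_col:
  fixes g :: "complex \<Rightarrow> complex"
  assumes "isCont g u" and "\<And>c. isCont (\<lambda>u. F u c) u"
  shows "isCont (\<lambda>u. gauge_col \<eta> \<xi> N q (g u) a (F u) c) u"
proof (induction N arbitrary: a c)
  case 0
  show ?case using assms by (cases a) (simp_all add: gauge_col_0)
next
  case (Suc N)
  have "isCont (\<lambda>u. g u - \<xi> (Suc N) + \<eta> / 2) u"
    using assms(1) by (intro continuous_add continuous_diff continuous_const)
  from isCont_weight [OF this] have "isCont (\<lambda>u. lax \<eta> (g u - \<xi> (Suc N) + \<eta> / 2) N a b
      (gauge_col \<eta> \<xi> N q (g u) b (F u)) c) u" for b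
    unfolding lax_weight by (intro continuous_add continuous_mult Suc.IH)
  then show ?case
    by (simp add: gauge_col_Suc UNIV_bool)
qed

text \<open>The state may vary together with the spectral parameter, because in a product of two
  operators the varied parameter may sit in the inner one.\<close>

lemma isCont_gauge_B:
  fixes g :: "complex \<Rightarrow> complex"
  assumes "isCont g u" and "\<And>c. isCont (\<lambda>u. F u c) u"
  shows "isCont (\<lambda>u. gauge_B N p q (g u) (F u) c) u"
  unfolding gauge_B_def by (intro continuous_intros isCont_gauge_col assms)

lemma gauge_B_symmetric:
  "gauge_B N p q u (gauge_B N (p * exp \<eta>) (q * exp (- \<eta>)) v f) c =
    gauge_B N p q v (gauge_B N (p * exp \<eta>) (q * exp (- \<eta>)) u f) c"
  (* The exchange relation degenerates if sinh (u - v - \<eta>) = 0; that case follows by continuity. *)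
proof (cases "sinh (u - v - \<eta>) = 0")
  case True
  define D where "D u = gauge_B N p q u (gauge_B N (p * exp \<eta>) (q * exp (- \<eta>)) v f) c -
    gauge_B N p q v (gauge_B N (p * exp \<eta>) (q * exp (- \<eta>)) u f) c" for u
  define r :: "nat \<Rightarrow> complex" where "r n = of_real (inverse (real (Suc n)))" for n
  have "isCont (\<lambda>u. gauge_B N p q u (gauge_B N (p * exp \<eta>) (q * exp (- \<eta>)) v f) c) u"
    by (rule isCont_gauge_B [where g = "\<lambda>u. u"]) (rule continuous_ident continuous_const)+
  moreover have "isCont (\<lambda>u. gauge_B N (p * exp \<eta>) (q * exp (- \<eta>)) u f c) u" for c
    by (rule isCont_gauge_B [where g = "\<lambda>u. u"]) (rule continuous_ident continuous_const)+
  then have "isCont (\<lambda>u. gauge_B N p q v (gauge_B N (p * exp \<eta>) (q * exp (- \<eta>)) u f) c) u"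
    by (rule isCont_gauge_B [where g = "\<lambda>u. v", OF continuous_const])
  ultimately have "isCont D u"
    unfolding D_def by (rule continuous_diff)
  moreover have "(\<lambda>n. u + r n) \<longlonglongrightarrow> u + of_real 0"
    unfolding r_def
    by (rule tendsto_add [OF tendsto_const tendsto_of_real [OF LIMSEQ_inverse_real_of_nat]])
  ultimately have lim: "(\<lambda>n. D (u + r n)) \<longlonglongrightarrow> D u"
    by (intro isCont_tendsto_compose [of u D]) simp_all
  \<comment> \<open>The shifted points are generic: at a zero of sinh the addition theorem leaves
    cosh (u - v - \<eta>) * sinh (r n), where the first factor is nonzero and \<open>r n\<close> is
    real and positive.\<close>
  have "D (u + r n) = 0" for n
  proof -
    have "sinh (u - v - \<eta>) = 0 \<Longrightarrow> cosh (u - v - \<eta>) \<noteq> 0"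
      using cosh_square_eq [of "u - v - \<eta>"] by auto
    moreover have "sinh (r n) \<noteq> 0"
    proof
      assume "sinh (r n) = 0"
      then have "of_real (exp (inverse (real (Suc n)))) = (of_real (exp (- inverse (real (Suc n)))) :: complex)"
        unfolding r_def sinh_field_def by (simp flip: exp_of_real)
      then show False unfolding of_real_eq_iff by simp
    qed
    ultimately have "sinh (u + r n - v - \<eta>) \<noteq> 0"
      using True sinh_add [of "u - v - \<eta>" "r n"] by (simp add: algebra_simps)
    from gauge_B_symmetric_generic [OF this] show ?thesis
      by (simp add: D_def)
  qed
  with lim have "D u = 0"
    by (simp add: LIMSEQ_const_iff)
  then show ?thesis by (simp add: D_def)
qed (rule gauge_B_symmetric_generic)

text \<open>The two coefficients add up to 1 because the product of two upper components occurs with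
  coefficient 1 in all three terms. The mixed products then determine
  \<open>\<gamma>\<close>.\<close>

lemma gauge_B_exchange:
  assumes "sinh (v - u) \<noteq> 0" and "p * exp \<eta> \<noteq> s * exp (- \<eta>) * exp (- \<eta>)"
  defines "\<gamma> \<equiv> ratio_minus \<eta> (v - u) * (p - s * exp (- \<eta>)) / (p * exp \<eta> - s * exp (- \<eta>) * exp (- \<eta>))"
  shows "gauge_B N s q v (gauge_B N p (q * exp (- \<eta>)) u f) c =
    \<gamma> * gauge_B N (p * exp \<eta>) q u (gauge_B N (s * exp (- \<eta>)) (q * exp (- \<eta>)) v f) c +
    (1 - \<gamma>) * gauge_B N (p * exp \<eta>) q v (gauge_B N (s * exp (- \<eta>)) (q * exp (- \<eta>)) u f) c"
proof -
  note sw = gauge_col_swap [where N = N and q = q and u = v and v = u and f = f and c = c]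
  have w: "exp \<eta> * sinh (v - u) * exp (- v) - sinh \<eta> * exp (- u) = sinh (v - u - \<eta>) * exp (- v)"
    unfolding sinh_diff_exp(1) by (simp add: exp_diff exp_minus field_simps)
  have w': "sinh (v - u) * exp (- u) - exp \<eta> * sinh \<eta> * exp (- v) =
      sinh (v - u - \<eta>) * exp \<eta> * exp (- u)"
    unfolding sinh_diff_exp(2) by (simp add: exp_diff exp_minus field_simps)
  define \<delta> where "\<delta> = sinh (v - u) * (p * exp \<eta> - s * exp (- \<eta>) * exp (- \<eta>))"
  have \<delta>: "\<delta> \<noteq> 0" using assms(1,2) by (simp add: \<delta>_def)
  have \<gamma>: "\<delta> * \<gamma> = sinh (v - u - \<eta>) * (p - s * exp (- \<eta>))"
    using assms(1,2) by (simp add: \<gamma>_def \<delta>_def)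
  have "\<delta> * gauge_B N s q v (gauge_B N p (q * exp (- \<eta>)) u f) c =
    (\<delta> * \<gamma>) * gauge_B N (p * exp \<eta>) q u (gauge_B N (s * exp (- \<eta>)) (q * exp (- \<eta>)) v f) c +
    (\<delta> - \<delta> * \<gamma>) * gauge_B N (p * exp \<eta>) q v (gauge_B N (s * exp (- \<eta>)) (q * exp (- \<eta>)) u f) c"
    unfolding gauge_B_gauge_B \<gamma> unfolding \<delta>_def
    by (rule exchange_coefficients [OF sw(1) sw(1) sw(2,3) w w' exp_minus_inverse])
  also have "\<dots> = \<delta> * (\<gamma> * gauge_B N (p * exp \<eta>) q u (gauge_B N (s * exp (- \<eta>)) (q * exp (- \<eta>)) v f) c +
    (1 - \<gamma>) * gauge_B N (p * exp \<eta>) q v (gauge_B N (s * exp (- \<eta>)) (q * exp (- \<eta>)) u f) c)"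
    by (simp add: algebra_simps)
  finally show ?thesis using \<delta> by simp
qed

end

section \<open>The boundary operator and the action on the reference state\<close>

text \<open>The X11 and X00 terms drop out of the difference. In the mixed terms the intertwining
  conditions on U and V split off the common factor p - r t', so p and r survive in this factor
  only.\<close>

lemma antisymmetric_coefficients:
  fixes a :: "complex"
  assumes "a * Y11 = a * X11" "a * Y00 = a * X00"
    and Y: "a * Y01 = b * X10 - s * X01" "a * Y10 = b * X01 - s * X10"
    and U: "t * b * U - s * V = a * U" "b * V - t * s * U = a * t * V"
    and t: "t * t' = 1"
  shows "b * (p - r * t') * (V * X01 - t * U * X10) =
    a * ((p * r * U * V * X11 - p * U * X10 - r * V * X01 + X00) -
      (p * r * V * U * Y11 - p * V * Y10 - r * U * Y01 + Y00))"
proof -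
  have t0: "t \<noteq> 0" and t': "t' = inverse t" using t inverse_unique [OF t] by auto
  have "a * ((p * r * U * V * X11 - p * U * X10 - r * V * X01 + X00) -
      (p * r * V * U * Y11 - p * V * Y10 - r * U * Y01 + Y00)) =
    p * r * U * V * (a * X11) - p * (a * U) * X10 - r * (a * V) * X01 + a * X00 -
    (p * r * V * U * (a * Y11) - p * V * (a * Y10) - r * U * (a * Y01) + a * Y00)"
    by (simp add: algebra_simps)
  also have "a * V = t' * (b * V - t * s * U)"
    unfolding U(2) t' using t0 by (simp add: field_simps)
  finally show ?thesis
    unfolding assms(1,2) Y U(1) [symmetric] t' using t0 by (simp add: field_simps)
qed

context
  fixes \<eta> :: complex and \<xi> :: "nat \<Rightarrow> complex"
begin

text \<open>The boundary operator as a bilinear expression in bulk columns at u and -u. Only mixed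
  spins occur because the boundary matrix is diagonal and crossing flips the spin of the outer
  column; the sign (-1)^N comes from the inner monodromy matrix.\<close>

definition boundary_B :: "nat \<Rightarrow> complex \<Rightarrow> complex \<Rightarrow> state \<Rightarrow> state" where
  "boundary_B N q u f = (\<lambda>c. (- 1) ^ N / (2 * q) *
     (exp u * gauge_col \<eta> \<xi> N q u False (gauge_col \<eta> \<xi> N (q * exp (- \<eta>)) (- u) True f) c -
      exp (\<eta> - u) * gauge_col \<eta> \<xi> N q u True (gauge_col \<eta> \<xi> N (q * exp (- \<eta>)) (- u) False f) c))"

lemma boundary_B_expansion:
  assumes "sinh (2 * u) \<noteq> 0" and "p \<noteq> s * exp (- \<eta>)"
  shows "boundary_B N q u f c = (- 1) ^ N / (2 * q) * sinh (2 * u - \<eta>) /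
     (sinh (2 * u) * (p - s * exp (- \<eta>))) *
     (gauge_B \<eta> \<xi> N p q u (gauge_B \<eta> \<xi> N s (q * exp (- \<eta>)) (- u) f) c -
      gauge_B \<eta> \<xi> N p q (- u) (gauge_B \<eta> \<xi> N s (q * exp (- \<eta>)) u f) c)"
proof -
  note sw = gauge_col_swap [where \<eta> = \<eta> and \<xi> = \<xi> and N = N and q = q and u = u and v = "- u"
      and f = f and c = c]
  have dbl: "exp (u - (- u)) = exp u * exp u" "exp (- (u - (- u))) = exp (- u) * exp (- u)"
    by (simp_all flip: exp_add)
  have w: "exp \<eta> * sinh (u - (- u)) * exp (- u) - sinh \<eta> * exp (- (- u)) = sinh (u - (- u) - \<eta>) * exp (- u)"
    unfolding sinh_diff_exp(1) [of "u - (- u)"] dbl by (simp add: exp_minus field_simps)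
  have w': "sinh (u - (- u)) * exp (- (- u)) - exp \<eta> * sinh \<eta> * exp (- u) =
      sinh (u - (- u) - \<eta>) * exp \<eta> * exp (- (- u))"
    unfolding sinh_diff_exp(2) [of "u - (- u)"] dbl by (simp add: exp_minus field_simps)
  let ?X = "exp u * gauge_col \<eta> \<xi> N q u False (gauge_col \<eta> \<xi> N (q * exp (- \<eta>)) (- u) True f) c -
      exp \<eta> * exp (- u) * gauge_col \<eta> \<xi> N q u True (gauge_col \<eta> \<xi> N (q * exp (- \<eta>)) (- u) False f) c"
  let ?W = "gauge_B \<eta> \<xi> N p q u (gauge_B \<eta> \<xi> N s (q * exp (- \<eta>)) (- u) f) c -
      gauge_B \<eta> \<xi> N p q (- u) (gauge_B \<eta> \<xi> N s (q * exp (- \<eta>)) u f) c"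
  have "sinh (2 * u) * (p - s * exp (- \<eta>)) * ?X = sinh (2 * u - \<eta>) * ?W"
    using antisymmetric_coefficients [OF sw(1) sw(1) sw(2,3) w w' exp_minus_inverse, of p s]
    unfolding gauge_B_gauge_B by simp
  then have "?X = sinh (2 * u - \<eta>) * ?W / (sinh (2 * u) * (p - s * exp (- \<eta>)))"
    using assms by (simp only: eq_divide_eq mult.commute) simp
  then show ?thesis
    unfolding boundary_B_def by (simp add: mult_exp_exp)
qed

(* Q stands for exp (\<eta> * (N - y)); replacing y by y + 1 divides Q by exp \<eta>, whatever N is. *)
definition product_state :: "nat \<Rightarrow> complex \<Rightarrow> state" where
  "product_state N Q = (\<lambda>c. \<Prod>n\<in>{1..N}. if c (n - 1) then 1 else Q * exp (- (of_nat n * \<eta>) - \<xi> n))"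

text \<open>A column of the first N sites sees the spin at a later site as a constant, so the factor
  of a product state at a new last site can be split off.\<close>

lemma gauge_col_mult_site:
  "N \<le> n \<Longrightarrow> gauge_col \<eta> \<xi> N q u a (\<lambda>c. h (c n) * F c) = (\<lambda>c. h (c n) * gauge_col \<eta> \<xi> N q u a F c)"
proof (induction N arbitrary: a)
  case 0
  show ?case by (simp add: gauge_col_0 fun_eq_iff)
next
  case (Suc N)
  then show ?case by (simp add: gauge_col_Suc fun_eq_iff UNIV_bool lax_def algebra_simps)
qed

lemma gauge_col_indep_site:
  assumes "\<And>c. F (c(n := b)) = F c"
  shows "N \<le> n \<Longrightarrow> gauge_col \<eta> \<xi> N q u a F (c(n := b)) = gauge_col \<eta> \<xi> N q u a F c"
proof (induction N arbitrary: a c)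
  case 0
  show ?case unfolding gauge_col_0 assms ..
next
  case (Suc N)
  then have tw: "c(n := b, N := a) = c(N := a, n := b)" and cN: "(c(n := b)) N = c N" for a
    by (simp_all add: fun_upd_twist)
  have lax_upd: "lax \<eta> w N a d G (c(n := b)) = lax \<eta> w N a d (\<lambda>c. G (c(n := b))) c" for w d G
    unfolding lax_def tw cN ..
  have col_upd: "(\<lambda>c. gauge_col \<eta> \<xi> N q u d F (c(n := b))) = gauge_col \<eta> \<xi> N q u d F" for d
    by (rule ext, rule Suc.IH, rule Suc_leD, rule Suc.prems)
  have "lax \<eta> w N a d (gauge_col \<eta> \<xi> N q u d F) (c(n := b)) =
      lax \<eta> w N a d (gauge_col \<eta> \<xi> N q u d F) c" for w d
    by (subst lax_upd, subst col_upd) (rule refl)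
  then show ?case unfolding gauge_col_Suc by (intro sum.cong refl)
qed

lemma product_state_indep: "N \<le> n \<Longrightarrow> product_state N Q (c(n := b)) = product_state N Q c"
  unfolding product_state_def by (intro prod.cong) auto

lemma product_state_Suc: "product_state (Suc N) Q =
   (\<lambda>c. (if c N then 1 else Q * exp (- (of_nat (Suc N) * \<eta>) - \<xi> (Suc N))) * product_state N Q c)"
  by (simp add: product_state_def fun_eq_iff mult.commute)

text \<open>The covector (p e^(-v), -1), applied to the last Lax operator on the local vector (g,
  1), gives sinh w times (g e^(-\<eta>), 1) and the covector with p e^\<eta>, provided that g e^(-w)
  = p e^(-v). The factor e^(-n \<eta>) in the state at site n makes this condition hold at every
  site; the chain without sites contributes the scalar Q e^(-\<eta>/2) - q.\<close>

lemma gauge_B_product_state: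
  "gauge_B \<eta> \<xi> N (Q * exp (- (of_nat N * \<eta> + \<eta> / 2))) q v (product_state N Q) =
    (\<lambda>c. (Q * exp (- \<eta> / 2) - q) * a_fun N \<eta> \<xi> v * product_state N (Q * exp (- \<eta>)) c)"
proof (induction N)
  case 0
  show ?case
    by (simp add: gauge_B_def gauge_col_0 product_state_def a_fun_def exp_minus field_simps)
next
  case (Suc N)
  define s where "s = Q * exp (- (of_nat N * \<eta> + \<eta> / 2))"
  define w where "w = v - \<xi> (Suc N) + \<eta> / 2"
  define g where "g = Q * exp (- (of_nat (Suc N) * \<eta>) - \<xi> (Suc N))"
  define h where "h = (\<lambda>b. if b then 1 else g)"
  define Y where "Y b = gauge_col \<eta> \<xi> N q v b (product_state N Q)" for b
  have col: "gauge_col \<eta> \<xi> N q v b (product_state (Suc N) Q) = (\<lambda>c. h (c N) * Y b c)" for b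
    unfolding product_state_Suc Y_def h_def g_def
    by (rule gauge_col_mult_site [where h = "\<lambda>b. if b then 1 else Q * exp (- (of_nat (Suc N) * \<eta>) - \<xi> (Suc N))"]) simp
  have Yupd: "Y b (c(N := x)) = Y b c" for b c x
    unfolding Y_def by (intro gauge_col_indep_site product_state_indep) simp_all
  have IH: "s * exp (- v) * Y True c - Y False c =
      (Q * exp (- \<eta> / 2) - q) * a_fun N \<eta> \<xi> v * product_state N (Q * exp (- \<eta>)) c" for c
    using fun_cong [OF Suc.IH, of c] by (simp add: gauge_B_def s_def Y_def)
  have "- (of_nat (Suc N) * \<eta> + \<eta> / 2) = - (of_nat N * \<eta> + \<eta> / 2) + - \<eta>"
    by (simp add: algebra_simps)
  then have s': "Q * exp (- (of_nat (Suc N) * \<eta> + \<eta> / 2)) = s * exp (- \<eta>)"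
    by (simp only: exp_add s_def mult.assoc)
  have "- (of_nat (Suc N) * \<eta>) - \<xi> (Suc N) + - w = - (of_nat (Suc N) * \<eta> + \<eta> / 2) + - v"
    by (simp add: w_def)
  \<comment> \<open>The matching condition between local vector and row covector; it is the only
    place where the value of the row parameter enters the step.\<close>
  then have gw: "g * exp (- w) = s * exp (- \<eta>) * exp (- v)"
    unfolding g_def s' [symmetric] by (simp only: mult.assoc exp_add [symmetric])
  have eq: "sinh (w - \<eta>) * exp (- w) + sinh \<eta> = exp \<eta> * exp (- w) * sinh w"
    unfolding sinh_diff_exp(1) by (simp add: exp_minus field_simps)
  have "s * exp (- \<eta>) * exp (- v) * sinh (w - \<eta>) + sinh \<eta> * g =
      g * (sinh (w - \<eta>) * exp (- w) + sinh \<eta>)"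
    unfolding gw [symmetric] by (simp add: algebra_simps)
  also have "\<dots> = exp \<eta> * (g * exp (- w)) * sinh w"
    unfolding eq by (simp add: algebra_simps)
  also have "\<dots> = (exp \<eta> * exp (- \<eta>)) * (sinh w * (s * exp (- v)))"
    unfolding gw by (simp add: algebra_simps)
  finally have minus: "s * exp (- \<eta>) * exp (- v) * sinh (w - \<eta>) + sinh \<eta> * g = sinh w * (s * exp (- v))"
    by (simp add: exp_minus_inverse)
  have plus: "s * exp (- \<eta>) * exp (- v) * sinh \<eta> + sinh (w - \<eta>) * g = g * exp (- \<eta>) * sinh w"
    unfolding gw [symmetric] sinh_diff_exp(2) by (simp add: algebra_simps)
  have "gauge_B \<eta> \<xi> (Suc N) (s * exp (- \<eta>)) q v (product_state (Suc N) Q) c =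
    (Q * exp (- \<eta> / 2) - q) * a_fun (Suc N) \<eta> \<xi> v * product_state (Suc N) (Q * exp (- \<eta>)) c" for c
  proof -
    have "gauge_B \<eta> \<xi> (Suc N) (s * exp (- \<eta>)) q v (product_state (Suc N) Q) c =
       s * exp (- \<eta>) * exp (- v) *
         (\<Sum>b\<in>UNIV. lax \<eta> w N True b (\<lambda>c. h (c N) * Y b c) c) -
         (\<Sum>b\<in>UNIV. lax \<eta> w N False b (\<lambda>c. h (c N) * Y b c) c)"
      unfolding gauge_B_def gauge_col_Suc col w_def ..
    also have "\<dots> = (if c N then 1 else g * exp (- \<eta>)) * sinh w * (s * exp (- v) * Y True c - Y False c)"
    proof (cases "c N")
      case True
      then have "s * exp (- \<eta>) * exp (- v) *
         (\<Sum>b\<in>UNIV. lax \<eta> w N True b (\<lambda>c. h (c N) * Y b c) c) -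
         (\<Sum>b\<in>UNIV. lax \<eta> w N False b (\<lambda>c. h (c N) * Y b c) c) =
         (s * exp (- \<eta>) * exp (- v) * sinh (w - \<eta>) + sinh \<eta> * g) * Y True c - sinh w * Y False c"
        by (simp add: UNIV_bool lax_def h_def Yupd algebra_simps)
      then show ?thesis unfolding minus using True by (simp add: algebra_simps)
    next
      case False
      then have "s * exp (- \<eta>) * exp (- v) *
         (\<Sum>b\<in>UNIV. lax \<eta> w N True b (\<lambda>c. h (c N) * Y b c) c) -
         (\<Sum>b\<in>UNIV. lax \<eta> w N False b (\<lambda>c. h (c N) * Y b c) c) =
         s * exp (- \<eta>) * exp (- v) * sinh w * g * Y True c -
         (s * exp (- \<eta>) * exp (- v) * sinh \<eta> + sinh (w - \<eta>) * g) * Y False c"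
        by (simp add: UNIV_bool lax_def h_def Yupd algebra_simps)
      then show ?thesis unfolding plus using False by (simp add: algebra_simps)
    qed
    finally have step: "gauge_B \<eta> \<xi> (Suc N) (s * exp (- \<eta>)) q v (product_state (Suc N) Q) c =
        (if c N then 1 else g * exp (- \<eta>)) * sinh w *
        ((Q * exp (- \<eta> / 2) - q) * a_fun N \<eta> \<xi> v * product_state N (Q * exp (- \<eta>)) c)"
      unfolding IH .
    have "product_state (Suc N) (Q * exp (- \<eta>)) c =
        (if c N then 1 else g * exp (- \<eta>)) * product_state N (Q * exp (- \<eta>)) c"
      by (simp add: product_state_Suc g_def)
    moreover have "a_fun (Suc N) \<eta> \<xi> v = sinh w * a_fun N \<eta> \<xi> v"
      by (simp add: a_fun_def w_def)
    ultimately show ?thesis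
      unfolding step by (simp only: mult_ac)
  qed
  then show ?case unfolding s' by blast
qed

end

section \<open>Moving the diagonal operator to the right\<close>

text \<open>After expanding everything in coth, the difference of the two sides is a multiple of the
  addition theorem for coth, applied to v - y = (v - x) + (x - y).\<close>

lemma coth_dynamical_identity:
  fixes v x y e :: complex
  assumes "sinh (v - x) \<noteq> 0" "sinh (v - y) \<noteq> 0" "sinh (x - y) \<noteq> 0"
    and "F = E * cosh e + sinh e * D"
  shows "F + sinh (v - x - e) / sinh (v - x) * D * (cosh (v - y) / sinh (v - y)) +
      sinh e * (E + D * (cosh (v - x) / sinh (v - x))) * (cosh (x - y) / sinh (x - y)) =
    (E + D * (cosh (v - y) / sinh (v - y))) * (sinh (y - x - e) / sinh (y - x))"
proof -
  define A where "A = cosh (v - x) / sinh (v - x)"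
  define B where "B = cosh (v - y) / sinh (v - y)"
  define C where "C = cosh (x - y) / sinh (x - y)"
  have "v - y = (v - x) + (x - y)" by simp
  then have "sinh (v - y) = sinh (v - x) * cosh (x - y) + cosh (v - x) * sinh (x - y)"
    "cosh (v - y) = cosh (v - x) * cosh (x - y) + sinh (v - x) * sinh (x - y)"
    by (metis sinh_add, metis cosh_add)
  then have ABC: "1 + A * C = B * (A + C)"
    using assms(1-3) unfolding A_def B_def C_def by (simp add: divide_simps) (simp add: algebra_simps)
  have first: "sinh (v - x - e) / sinh (v - x) = cosh e - A * sinh e"
    using assms(1) unfolding A_def sinh_diff by (simp add: field_simps)
  have second: "sinh (y - x - e) / sinh (y - x) = cosh e + C * sinh e"
  proof -
    have "sinh (y - x - e) / sinh (y - x) = sinh (x - y + e) / sinh (x - y)"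
      using sinh_minus [of "x - y + e"] sinh_minus [of "x - y"] by (simp add: algebra_simps)
    then show ?thesis
      using assms(3) unfolding C_def sinh_add by (simp add: field_simps)
  qed
  have "F + sinh (v - x - e) / sinh (v - x) * D * B + sinh e * (E + D * A) * C -
     (E + D * B) * (sinh (y - x - e) / sinh (y - x)) = sinh e * D * (1 + A * C - B * (A + C))"
    unfolding assms(4) first second by (simp add: algebra_simps)
  from this [unfolded ABC diff_self mult_zero_right] show ?thesis
    unfolding A_def B_def C_def by (simp only: right_minus_eq)
qed

context
  fixes \<eta> :: complex and \<xi> :: "nat \<Rightarrow> complex"
begin

primrec gauge_B_list :: "nat \<Rightarrow> complex list \<Rightarrow> complex \<Rightarrow> complex \<Rightarrow> state \<Rightarrow> state" where
  "gauge_B_list N [] p q f = f"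
| "gauge_B_list N (u # us) p q f =
     gauge_B \<eta> \<xi> N p q u (gauge_B_list N us (p * exp \<eta>) (q * exp (- \<eta>)) f)"

lemma gauge_B_list_swap: "gauge_B_list N (u # v # us) p q f = gauge_B_list N (v # u # us) p q f"
  unfolding gauge_B_list.simps by (rule ext) (rule gauge_B_symmetric)

definition omit :: "nat \<Rightarrow> 'a list \<Rightarrow> 'a list" where
  "omit j xs = take j xs @ drop (Suc j) xs"

lemma omit_simps [simp]: "omit 0 (x # xs) = xs" "omit (Suc j) (x # xs) = x # omit j xs"
  by (simp_all add: omit_def)

text \<open>The weight collected when u_j takes the place of v in the diagonal operator, passes all
  other operators and reaches the reference state.\<close>

definition exchange_coeff :: "nat \<Rightarrow> complex list \<Rightarrow> nat \<Rightarrow> complex" where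
  "exchange_coeff N us j = a_fun N \<eta> \<xi> (us ! j) *
     (\<Prod>i<length us. if i = j then 1 else ratio_minus \<eta> (us ! j - us ! i))"

lemma exchange_coeff_Cons:
  "exchange_coeff N (u # us) 0 = a_fun N \<eta> \<xi> u * (\<Prod>i<length us. ratio_minus \<eta> (u - us ! i))"
  "exchange_coeff N (u # us) (Suc j) = ratio_minus \<eta> (us ! j - u) * exchange_coeff N us j"
  by (simp_all add: exchange_coeff_def prod.lessThan_Suc_shift del: prod.lessThan_Suc cong: if_cong)

text \<open>At each exchange either v travels on, or its neighbour takes over the role of the moving
  operator and v stays behind. The coefficient E + D coth (v - u_j), with E = p + s e^(-\<eta>) and
  D = p - s e^(-\<eta>), equals (p e^w - s e^(-\<eta>) e^(-w)) / sinh w at w = v - u_j; the coth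
  form isolates the part independent of v.\<close>

lemma gauge_B_move_right:
  fixes p q s Q v :: complex and us :: "complex list"
  assumes "\<And>k. k \<le> length us \<Longrightarrow> p * exp \<eta> ^ k \<noteq> s * exp (- \<eta>) ^ Suc k"
    and "sorted_wrt (\<lambda>u w. sinh (u - w) \<noteq> 0) (v # us)"
    and "s * exp (- \<eta>) ^ length us = Q * exp (- (of_nat N * \<eta> + \<eta> / 2))"
  shows "gauge_B \<eta> \<xi> N s q v (gauge_B_list N us p (q * exp (- \<eta>)) (product_state \<eta> \<xi> N Q)) c =
    (Q * exp (- \<eta> / 2) - q * exp (- \<eta>) ^ length us) /
      (p * exp \<eta> ^ length us - s * exp (- \<eta>) ^ Suc (length us)) *
    ((p - s * exp (- \<eta>)) * a_fun N \<eta> \<xi> v * (\<Prod>i<length us. ratio_minus \<eta> (v - us ! i)) *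
       gauge_B_list N us (p * exp \<eta>) q (product_state \<eta> \<xi> N (Q * exp (- \<eta>))) c +
     sinh \<eta> * (\<Sum>j<length us.
       ((p + s * exp (- \<eta>)) + (p - s * exp (- \<eta>)) * (cosh (v - us ! j) / sinh (v - us ! j))) *
       exchange_coeff N us j *
       gauge_B_list N (v # omit j us) (p * exp \<eta>) q (product_state \<eta> \<xi> N (Q * exp (- \<eta>))) c))"
  using assms
proof (induction us arbitrary: p q s v c)
  case Nil
  have "p \<noteq> s * exp (- \<eta>)" using Nil.prems(1) [of 0] by simp
  moreover have "s = Q * exp (- (of_nat N * \<eta> + \<eta> / 2))" using Nil.prems(3) by simp
  ultimately show ?case
    using fun_cong [OF gauge_B_product_state [of \<eta> \<xi> N Q q v], of c] by simp
next
  case (Cons u us)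
  define t t' where "t = exp \<eta>" and "t' = exp (- \<eta>)"
  note tt = t_def [symmetric] t'_def [symmetric]
  define n where "n = length us"
  define R where "R = product_state \<eta> \<xi> N (Q * t')"
  define K where "K = (Q * exp (- \<eta> / 2) - q * t' * t' ^ n) / (p * t * t ^ n - s * t' * t' ^ Suc n)"
  define D0 D1 E0 E1 where "D0 = p - s * t'" and "D1 = p * t - s * t' * t'"
    and "E0 = p + s * t'" and "E1 = p * t + s * t' * t'"
  define \<gamma> where "\<gamma> = ratio_minus \<eta> (v - u) * D0 / D1"
  define coth :: "complex \<Rightarrow> complex" where "coth w = cosh w / sinh w" for w
  have D1: "D1 \<noteq> 0"
    using Cons.prems(1) [of 1] by (simp add: D1_def t_def t'_def mult.assoc)
  have nz: "sinh (v - u) \<noteq> 0" "\<And>j. j < n \<Longrightarrow> sinh (v - us ! j) \<noteq> 0"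
    "\<And>j. j < n \<Longrightarrow> sinh (u - us ! j) \<noteq> 0"
    using Cons.prems(2) by (simp_all add: n_def)
  have t: "t = cosh \<eta> + sinh \<eta>" "t' = cosh \<eta> - sinh \<eta>"
    by (simp_all add: t_def t'_def cosh_plus_sinh cosh_minus_sinh)
  have IH: "gauge_B \<eta> \<xi> N (s * t') (q * t') w (gauge_B_list N us (p * t) (q * t' * t') (product_state \<eta> \<xi> N Q)) c =
    K * (D1 * a_fun N \<eta> \<xi> w * (\<Prod>i<n. ratio_minus \<eta> (w - us ! i)) * gauge_B_list N us (p * t * t) (q * t') R c +
     sinh \<eta> * (\<Sum>j<n. (E1 + D1 * coth (w - us ! j)) * exchange_coeff N us j *
       gauge_B_list N (w # omit j us) (p * t * t) (q * t') R c))"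
    if "w = u \<or> w = v" for w c
    unfolding K_def D1_def E1_def R_def n_def coth_def t_def t'_def
  proof (rule Cons.IH)
    show "p * exp \<eta> * exp \<eta> ^ k \<noteq> s * exp (- \<eta>) * exp (- \<eta>) ^ Suc k" if "k \<le> length us" for k
      using Cons.prems(1) [of "Suc k"] that by (simp add: mult.assoc)
    show "sorted_wrt (\<lambda>u w. sinh (u - w) \<noteq> 0) (w # us)"
      using Cons.prems(2) \<open>w = u \<or> w = v\<close> by auto
    show "s * exp (- \<eta>) * exp (- \<eta>) ^ length us = Q * exp (- (of_nat N * \<eta> + \<eta> / 2))"
      using Cons.prems(3) by (simp add: mult.assoc)
  qed
  note lin = linear_gauge_B [of \<eta> \<xi> N "p * t" q]
  have step: "gauge_B \<eta> \<xi> N (p * t) q w' (gauge_B \<eta> \<xi> N (s * t') (q * t') w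
      (gauge_B_list N us (p * t) (q * t' * t') (product_state \<eta> \<xi> N Q))) c =
    K * (D1 * a_fun N \<eta> \<xi> w * (\<Prod>i<n. ratio_minus \<eta> (w - us ! i)) * gauge_B_list N (w' # us) (p * t) q R c +
     sinh \<eta> * (\<Sum>j<n. (E1 + D1 * coth (w - us ! j)) * exchange_coeff N us j *
       gauge_B_list N (w' # w # omit j us) (p * t) q R c))"
    if "w = u \<or> w = v" for w w'
    unfolding ext [OF IH [OF that]] linear_op_scale [OF lin] linear_op_add [OF lin]
      linear_op_sum [OF lin] gauge_B_list.simps tt ..
  have g1: "\<gamma> * D1 = ratio_minus \<eta> (v - u) * D0"
    using D1 by (simp add: \<gamma>_def)
  \<comment> \<open>One exchange multiplies p by e^\<eta> and s e^(-\<eta>) by e^(-\<eta>), a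
    hyperbolic rotation by \<eta> of their sum and difference.\<close>
  have E1: "E1 = E0 * cosh \<eta> + sinh \<eta> * D0" and D1': "D1 = D0 * cosh \<eta> + sinh \<eta> * E0"
    unfolding E0_def E1_def D0_def D1_def t using hyperbolic_pythagoras [of \<eta>]
    by (simp_all add: algebra_simps power2_eq_square)
  \<comment> \<open>The coefficient for the takeover by the first neighbour u, that is, the new
    summand j = 0.\<close>
  have g2: "(1 - \<gamma>) * D1 = sinh \<eta> * (E0 + D0 * coth (v - u))"
  proof -
    have "(1 - \<gamma>) * D1 = D1 - ratio_minus \<eta> (v - u) * D0" using g1 by (simp add: algebra_simps)
    then show ?thesis
      unfolding D1' coth_def sinh_diff [of "v - u" \<eta>] using nz(1) by (simp add: field_simps)
  qed
  \<comment> \<open>There are two ways for \<open>us ! j\<close> to become the moving parameter: it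
    takes over from v directly, or from u after u has taken over from v. Both leave u and v among
    the B operators, whose order is immaterial, so the coefficients add up.\<close>
  have g3: "\<gamma> * (E1 + D1 * coth (v - us ! j)) + (1 - \<gamma>) * (E1 + D1 * coth (u - us ! j)) =
      (E0 + D0 * coth (v - us ! j)) * ratio_minus \<eta> (us ! j - u)" if "j < n" for j
  proof -
    have "\<gamma> * (E1 + D1 * coth (v - us ! j)) + (1 - \<gamma>) * (E1 + D1 * coth (u - us ! j)) =
      E1 + (\<gamma> * D1) * coth (v - us ! j) + ((1 - \<gamma>) * D1) * coth (u - us ! j)"
      by (simp add: algebra_simps)
    also have "\<dots> = (E0 + D0 * coth (v - us ! j)) * ratio_minus \<eta> (us ! j - u)"
      unfolding g1 g2 coth_def using nz that E1 by (intro coth_dynamical_identity)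
    finally show ?thesis .
  qed
  have sum_combination: "(\<Sum>j<n. (\<gamma> * x j + \<delta> * y j) * e j * h j) =
      \<gamma> * (\<Sum>j<n. x j * e j * h j) + \<delta> * (\<Sum>j<n. y j * e j * h j)"
    for \<gamma> \<delta> :: complex and x y e h
    by (simp add: sum_distrib_left algebra_simps flip: sum.distrib)
  let ?G = "\<lambda>us. gauge_B_list N us (p * t) q R c"
  have "gauge_B \<eta> \<xi> N s q v (gauge_B_list N (u # us) p (q * t') (product_state \<eta> \<xi> N Q)) c =
     \<gamma> * (K * (D1 * a_fun N \<eta> \<xi> v * (\<Prod>i<n. ratio_minus \<eta> (v - us ! i)) * ?G (u # us) +
       sinh \<eta> * (\<Sum>j<n. (E1 + D1 * coth (v - us ! j)) * exchange_coeff N us j * ?G (u # v # omit j us)))) +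
     (1 - \<gamma>) * (K * (D1 * a_fun N \<eta> \<xi> u * (\<Prod>i<n. ratio_minus \<eta> (u - us ! i)) * ?G (v # us) +
       sinh \<eta> * (\<Sum>j<n. (E1 + D1 * coth (u - us ! j)) * exchange_coeff N us j * ?G (v # u # omit j us))))"
    unfolding gauge_B_list.simps(2)
    using gauge_B_exchange [of v u p \<eta> s \<xi> N q "gauge_B_list N us (p * t) (q * t' * t') (product_state \<eta> \<xi> N Q)" c]
      step [of u v] step [of v u] nz(1) D1
    by (simp add: tt \<gamma>_def D0_def D1_def)
  also have "\<dots> = K * ((\<gamma> * D1) * a_fun N \<eta> \<xi> v * (\<Prod>i<n. ratio_minus \<eta> (v - us ! i)) * ?G (u # us) +
      ((1 - \<gamma>) * D1) * (a_fun N \<eta> \<xi> u * (\<Prod>i<n. ratio_minus \<eta> (u - us ! i))) * ?G (v # us) +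
       sinh \<eta> * (\<Sum>j<n. (\<gamma> * (E1 + D1 * coth (v - us ! j)) + (1 - \<gamma>) * (E1 + D1 * coth (u - us ! j))) *
         exchange_coeff N us j * ?G (v # u # omit j us)))"
    unfolding gauge_B_list_swap [of N u v] sum_combination
    by (simp add: algebra_simps del: gauge_B_list.simps)
  also have "(\<Sum>j<n. (\<gamma> * (E1 + D1 * coth (v - us ! j)) + (1 - \<gamma>) * (E1 + D1 * coth (u - us ! j))) *
         exchange_coeff N us j * ?G (v # u # omit j us)) =
      (\<Sum>j<n. (E0 + D0 * coth (v - us ! j)) * exchange_coeff N (u # us) (Suc j) * ?G (v # omit (Suc j) (u # us)))"
    by (intro sum.cong refl) (simp add: g3 exchange_coeff_Cons)
  also have "K * ((\<gamma> * D1) * a_fun N \<eta> \<xi> v * (\<Prod>i<n. ratio_minus \<eta> (v - us ! i)) * ?G (u # us) +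
      ((1 - \<gamma>) * D1) * (a_fun N \<eta> \<xi> u * (\<Prod>i<n. ratio_minus \<eta> (u - us ! i))) * ?G (v # us) + sinh \<eta> * \<dots>) =
    K * (D0 * a_fun N \<eta> \<xi> v * (\<Prod>i<Suc n. ratio_minus \<eta> (v - (u # us) ! i)) * ?G (u # us) +
      sinh \<eta> * (\<Sum>j<Suc n. (E0 + D0 * coth (v - (u # us) ! j)) * exchange_coeff N (u # us) j *
        ?G (v # omit j (u # us))))"
    unfolding g1 g2 prod.lessThan_Suc_shift sum.lessThan_Suc_shift exchange_coeff_Cons n_def
    by (simp add: algebra_simps)
  finally show ?case
    by (simp add: tt K_def n_def D0_def E0_def R_def coth_def mult.assoc)
qed

end

section \<open>Products of boundary operators\<close>

definition sign_lists :: "nat \<Rightarrow> complex list set" where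
  "sign_lists n = {ss. set ss \<subseteq> {1, - 1} \<and> length ss = n}"

lemma finite_sign_lists: "finite (sign_lists n)"
  unfolding sign_lists_def by (rule finite_lists_length_eq) simp

lemma sign_lists_0: "sign_lists 0 = {[]}"
  by (auto simp: sign_lists_def)

lemma sum_sign_lists_Suc:
  "(\<Sum>ss\<in>sign_lists (Suc n). f ss) = (\<Sum>ss\<in>sign_lists n. f (1 # ss) + f (- 1 # ss))"
proof -
  have "sign_lists (Suc n) = Cons 1 ` sign_lists n \<union> Cons (- 1) ` sign_lists n"
    by (auto simp: sign_lists_def length_Suc_conv)
  moreover have "Cons 1 ` sign_lists n \<inter> Cons (- 1) ` sign_lists n = {}"
    by auto
  ultimately show ?thesis
    by (simp add: sum.union_disjoint finite_sign_lists sum.reindex sum.distrib)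
qed

lemma flip_sign_lists:
  "bij_betw (\<lambda>ss. ss[j := - ss ! j]) (sign_lists n) (sign_lists n)"
proof (rule bij_betw_byWitness [where f' = "\<lambda>ss. ss[j := - ss ! j]"])
  show "(\<lambda>ss. ss[j := - ss ! j]) ` sign_lists n \<subseteq> sign_lists n"
  proof safe
    fix ss assume ss: "ss \<in> sign_lists n"
    show "ss[j := - ss ! j] \<in> sign_lists n"
    proof (cases "j < n")
      case True
      with ss have "ss ! j \<in> {1, - 1}" by (auto simp: sign_lists_def dest: nth_mem)
      then have "- ss ! j \<in> {1, - 1}" by auto
      with ss show ?thesis
        using set_update_subset_insert [of ss j "- ss ! j"] by (auto simp: sign_lists_def)
    next
      case False
      with ss have "length ss \<le> j" by (simp add: sign_lists_def)
      with ss show ?thesis by (simp add: list_update_beyond)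
    qed
  qed
  then show "(\<lambda>ss. ss[j := - ss ! j]) ` sign_lists n \<subseteq> sign_lists n" .
  have "(ss[j := - ss ! j])[j := - ss[j := - ss ! j] ! j] = ss" for ss :: "complex list"
    by (cases "j < length ss") (simp_all add: list_update_beyond)
  then show "\<forall>ss\<in>sign_lists n. (ss[j := - ss ! j])[j := - ss[j := - ss ! j] ! j] = ss"
    "\<forall>ss\<in>sign_lists n. (ss[j := - ss ! j])[j := - ss[j := - ss ! j] ! j] = ss"
    by blast+
qed

lemma map2_mult_flip:
  "length ss = length ls \<Longrightarrow> j < length ls \<Longrightarrow>
   map2 (*) (ss[j := - ss ! j]) ls = (map2 (*) ss ls)[j := - (map2 (*) ss ls ! j :: complex)]"
  by (rule nth_equalityI) (auto simp: nth_list_update)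

lemma omit_update [simp]: "omit j (xs[j := x]) = omit j xs"
  by (simp add: omit_def)

context
  fixes \<eta> :: complex and \<xi> :: "nat \<Rightarrow> complex"
begin

lemma ratio_plus_minus: "ratio_plus \<eta> (- w) = ratio_minus \<eta> w"
  using sinh_minus [of "w - \<eta>"] by (simp add: algebra_simps)

(* For u_j = \<sigma>_j * \<lambda>_j the sign \<sigma>_j is absorbed by \<sigma>_j / sinh (2 * \<lambda>_j) = 1 / sinh (2 * u_j), so the
   coefficient depends on the u_j only. *)
primrec sign_coeff :: "nat \<Rightarrow> complex list \<Rightarrow> complex" where
  "sign_coeff N [] = 1"
| "sign_coeff N (u # us) =
     a_fun N \<eta> \<xi> (- u) / sinh (2 * u) * (\<Prod>i<length us. ratio_plus \<eta> (u + us ! i)) * sign_coeff N us"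

text \<open>a(u_j) a(-u_j) is even in u_j. For every other i the factors
  \<open>ratio_plus \<eta> (u_i + u_j)\<close> and \<open>ratio_minus \<eta> (u_j - u_i)\<close> are
  interchanged when u_j changes sign. What remains is 1 / sinh (2 u_j), which is odd.\<close>

lemma sign_coeff_exchange_coeff_odd:
  assumes "j < length us"
  shows "sign_coeff N (us[j := - us ! j]) * exchange_coeff \<eta> \<xi> N (us[j := - us ! j]) j =
    - (sign_coeff N us * exchange_coeff \<eta> \<xi> N us j)"
  using assms
proof (induction us arbitrary: j)
  case (Cons u us)
  show ?case
  proof (cases j)
    case 0
    have "ratio_plus \<eta> (- u + w) = ratio_minus \<eta> (u - w)" "ratio_minus \<eta> (- u - w) = ratio_plus \<eta> (u + w)" for w
      using ratio_plus_minus [of "u - w"] ratio_plus_minus [of "- u - w"] by (simp_all add: algebra_simps)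
    then show ?thesis
      by (simp add: 0 exchange_coeff_Cons)
  next
    case (Suc k)
    define x where "x = us ! k"
    have k: "k < length us" using Cons.prems Suc by simp
    have prod_split: "(\<Prod>i<length us. ratio_plus \<eta> (u + us[k := y] ! i)) =
        ratio_plus \<eta> (u + y) * (\<Prod>i\<in>{..<length us} - {k}. ratio_plus \<eta> (u + us ! i))" for y
      using k by (subst prod.remove [of _ k]) (auto intro!: prod.cong)
    have eq: "sign_coeff N ((u # us)[j := y]) * exchange_coeff \<eta> \<xi> N ((u # us)[j := y]) j =
        a_fun N \<eta> \<xi> (- u) / sinh (2 * u) * (\<Prod>i\<in>{..<length us} - {k}. ratio_plus \<eta> (u + us ! i)) *
        (ratio_plus \<eta> (u + y) * ratio_minus \<eta> (y - u)) *
        (sign_coeff N (us[k := y]) * exchange_coeff \<eta> \<xi> N (us[k := y]) k)" for y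
      using k by (simp add: Suc exchange_coeff_Cons prod_split mult_ac del: prod.lessThan_Suc)
    have "ratio_plus \<eta> (u - x) = ratio_minus \<eta> (x - u)" "ratio_minus \<eta> (- x - u) = ratio_plus \<eta> (u + x)"
      using ratio_plus_minus [of "x - u"] ratio_plus_minus [of "- x - u"] by (simp_all add: algebra_simps)
    then have "ratio_plus \<eta> (u + - x) * ratio_minus \<eta> (- x - u) = ratio_plus \<eta> (u + x) * ratio_minus \<eta> (x - u)" by (simp add: mult.commute)
    then show ?thesis
      using eq [of x] eq [of "- x"] Cons.IH [OF k] by (simp add: Suc x_def)
  qed
qed simp

text \<open>Flipping the j-th sign permutes the sign choices and negates each summand, as the
  remaining operators, collected in V, do not contain u_j.\<close>

lemma sum_sign_lists_odd:
  assumes "length ls = M" and "j < M" and even: "\<And>x. e (- x) = e x"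
  shows "(\<Sum>ss\<in>sign_lists M. sign_coeff N (map2 (*) ss ls) *
     exchange_coeff \<eta> \<xi> N (map2 (*) ss ls) j * e (map2 (*) ss ls ! j) * V (omit j (map2 (*) ss ls))) = 0"
    (is "?S = 0")
proof -
  let ?g = "\<lambda>us. sign_coeff N us * exchange_coeff \<eta> \<xi> N us j * e (us ! j) * V (omit j us)"
  have "?S = (\<Sum>ss\<in>sign_lists M. ?g (map2 (*) (ss[j := - ss ! j]) ls))"
    by (rule sum.reindex_bij_betw [OF flip_sign_lists, symmetric])
  also have "\<dots> = (\<Sum>ss\<in>sign_lists M. - ?g (map2 (*) ss ls))"
  proof (rule sum.cong [OF refl])
    fix ss assume "ss \<in> sign_lists M"
    then have len: "length ss = length ls" using assms by (simp add: sign_lists_def)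
    let ?us = "map2 (*) ss ls"
    have j: "j < length ?us" using len assms by simp
    have "?g (?us[j := - ?us ! j]) = - ?g ?us"
      using j unfolding sign_coeff_exchange_coeff_odd [OF j] by (simp add: even)
    then show "?g (map2 (*) (ss[j := - ss ! j]) ls) = - ?g ?us"
      using map2_mult_flip [OF len] assms by simp
  qed
  also have "\<dots> = - ?S" by (rule sum_negf)
  finally show ?thesis by simp
qed

primrec boundary_B_list :: "nat \<Rightarrow> complex list \<Rightarrow> complex \<Rightarrow> state \<Rightarrow> state" where
  "boundary_B_list N [] q f = f"
| "boundary_B_list N (l # ls) q f =
     boundary_B \<eta> \<xi> N q l (boundary_B_list N ls (q * exp (- \<eta>) * exp (- \<eta>)) f)"

text \<open>Each operator contributes its normalisation and the prefactor of
  \<open>gauge_B_move_right\<close>, for column parameter q e^(-\<eta>) and a reference state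
  lowered M times.\<close>

primrec gauge_coeff :: "nat \<Rightarrow> complex \<Rightarrow> complex \<Rightarrow> complex \<Rightarrow> nat \<Rightarrow> complex \<Rightarrow> complex" where
  "gauge_coeff N Q p s 0 q = 1"
| "gauge_coeff N Q p s (Suc M) q = (- 1) ^ N / (2 * q) *
     ((Q * exp (- \<eta>) ^ M * exp (- \<eta> / 2) - q * exp (- \<eta>) * exp (- \<eta>) ^ M) /
      (p * exp \<eta> ^ M - s * exp (- \<eta>) ^ Suc M)) *
     gauge_coeff N Q p s M (q * exp (- \<eta>) * exp (- \<eta>))"

text \<open>The gauge parameters fit as follows: the first boundary operator is B at (p, q) times D
  at (s, q e^(-\<eta>)), and by induction a string of B operators starting at (p, q e^(-2\<eta>))
  stands to its right. Moving D through turns this start into (p e^\<eta>, q e^(-\<eta>)), which is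
  what continues a string that begins at (p, q).\<close>

lemma boundary_B_list_expansion:
  fixes N Q p s ls
  assumes "\<And>l. l \<in> set ls \<Longrightarrow> sinh (2 * l) \<noteq> 0"
    and "sorted_wrt (\<lambda>l m. sinh (l + m) \<noteq> 0 \<and> sinh (l - m) \<noteq> 0) ls"
    and "\<And>k. k < length ls \<Longrightarrow> p * exp \<eta> ^ k \<noteq> s * exp (- \<eta>) ^ Suc k"
    and s: "s = Q * exp (- (of_nat N * \<eta> + \<eta> / 2))"
  shows "boundary_B_list N ls q (product_state \<eta> \<xi> N Q) c =
    gauge_coeff N Q p s (length ls) q * (\<Prod>l\<leftarrow>ls. sinh (2 * l - \<eta>)) *
    (\<Sum>ss\<in>sign_lists (length ls). sign_coeff N (map2 (*) ss ls) *
       gauge_B_list \<eta> \<xi> N (map2 (*) ss ls) p q (product_state \<eta> \<xi> N (Q * exp (- \<eta>) ^ length ls)) c)"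
  using assms(1-3)
proof (induction ls arbitrary: q c)
  case Nil
  show ?case by (simp add: sign_lists_0)
next
  case (Cons l ls)
  define t t' where "t = exp \<eta>" and "t' = exp (- \<eta>)"
  define M where "M = length ls"
  define us where "us ss = map2 (*) ss ls" for ss :: "complex list"
  have length_us: "length (us ss) = M" if "ss \<in> sign_lists M" for ss
    using that by (simp add: us_def M_def sign_lists_def)
  define D0 E0 where "D0 = p - s * t'" and "E0 = p + s * t'"
  define coth :: "complex \<Rightarrow> complex" where "coth w = cosh w / sinh w" for w
  define R where "R = product_state \<eta> \<xi> N (Q * t' ^ M)"
  define R' where "R' = product_state \<eta> \<xi> N (Q * t' ^ M * t')"
  define Kf where "Kf = gauge_coeff N Q p s M (q * t' * t') * (\<Prod>l\<leftarrow>ls. sinh (2 * l - \<eta>))"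
  define \<kappa> where "\<kappa> = (Q * t' ^ M * exp (- \<eta> / 2) - q * t' * t' ^ M) / (p * t ^ M - s * t' ^ Suc M)"
  define f where "f = boundary_B_list N ls (q * t' * t') (product_state \<eta> \<xi> N Q)"
  define H where "H ss = sign_coeff N (us ss)" for ss
  define G where "G us = gauge_B_list \<eta> \<xi> N us p q R' c" for us
  define ec where "ec ss j = exchange_coeff \<eta> \<xi> N (us ss) j" for ss j
  have f: "f = (\<lambda>c. Kf * (\<Sum>ss\<in>sign_lists M. H ss *
      gauge_B_list \<eta> \<xi> N (us ss) p (q * t' * t') R c))"
    unfolding f_def Kf_def H_def R_def M_def us_def t'_def
    by (rule ext, rule Cons.IH) (use Cons.prems in auto)
  have move: "gauge_B \<eta> \<xi> N s (q * t') v (gauge_B_list \<eta> \<xi> N (us ss) p (q * t' * t') R) c =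
    \<kappa> * (D0 * a_fun N \<eta> \<xi> v * (\<Prod>i<M. ratio_minus \<eta> (v - us ss ! i)) *
       gauge_B_list \<eta> \<xi> N (us ss) (p * t) (q * t') R' c +
     sinh \<eta> * (\<Sum>j<M. (E0 + D0 * coth (v - us ss ! j)) * ec ss j *
       gauge_B_list \<eta> \<xi> N (v # omit j (us ss)) (p * t) (q * t') R' c))"
    if ss: "ss \<in> sign_lists M" and v: "v = l \<or> v = - l" for ss v c
  proof -
    \<comment> \<open>For all choices of signs, a difference of two parameters is, up to sign, the
      sum or the difference of the original ones.\<close>
    have sorted: "sorted_wrt (\<lambda>u w. sinh (u - w) \<noteq> 0) (v # us ss)"
    proof -
      have sg: "us ss ! i = ls ! i \<or> us ss ! i = - ls ! i" if "i < M" for i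
      proof -
        have "ss ! i \<in> set ss" using ss that by (intro nth_mem) (simp add: sign_lists_def)
        then have "ss ! i \<in> {1, - 1}" using ss by (auto simp: sign_lists_def)
        moreover have "us ss ! i = ss ! i * ls ! i"
          using ss that by (simp add: us_def sign_lists_def M_def)
        ultimately show ?thesis by auto
      qed
      have "sinh (us ss ! i - us ss ! j) \<noteq> 0" if "i < j" "j < M" for i j
      proof -
        have "sinh (ls ! i + ls ! j) \<noteq> 0" "sinh (ls ! i - ls ! j) \<noteq> 0"
          using sorted_wrt_nth_less [of "\<lambda>l m. sinh (l + m) \<noteq> 0 \<and> sinh (l - m) \<noteq> 0" ls i j]
            Cons.prems(2) that by (simp_all add: M_def)
        then show ?thesis
          using sg [of i] sg [of j] that sinh_minus [of "ls ! i + ls ! j"] sinh_minus [of "ls ! i - ls ! j"]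
          by auto
      qed
      moreover have "sinh (v - us ss ! i) \<noteq> 0" if "i < M" for i
      proof -
        have "sinh (l + ls ! i) \<noteq> 0" "sinh (l - ls ! i) \<noteq> 0"
          using Cons.prems(2) that by (simp_all add: M_def)
        then show ?thesis
          using sg [of i] that v sinh_minus [of "l + ls ! i"] sinh_minus [of "l - ls ! i"]
          by auto
      qed
      ultimately show ?thesis
        using length_us [OF ss] unfolding sorted_wrt.simps(2)
        by (auto simp: sorted_wrt_iff_nth_less all_set_conv_all_nth)
    qed
    \<comment> \<open>s and Q are both lowered M times, so the choice of s that suits the original
      state also suits the state reached by the inner operators.\<close>
    have "s * exp (- \<eta>) ^ length (us ss) = Q * t' ^ M * exp (- (of_nat N * \<eta> + \<eta> / 2))"
      using length_us [OF ss] by (simp add: s t'_def)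
    from gauge_B_move_right [where p = p and q = "q * t'" and \<xi> = \<xi> and c = c, OF _ sorted this] show ?thesis
      using Cons.prems(3)
      by (simp add: length_us [OF ss] \<kappa>_def D0_def E0_def coth_def ec_def R_def R'_def M_def
          flip: t_def t'_def)
  qed
  have W: "gauge_B \<eta> \<xi> N p q w (gauge_B \<eta> \<xi> N s (q * t') v f) c = Kf * \<kappa> *
     (D0 * (\<Sum>ss\<in>sign_lists M. H ss * (a_fun N \<eta> \<xi> v * (\<Prod>i<M. ratio_minus \<eta> (v - us ss ! i))) * G (w # us ss)) +
      sinh \<eta> * (\<Sum>ss\<in>sign_lists M. \<Sum>j<M. H ss * ec ss j * (E0 + D0 * coth (v - us ss ! j)) *
         G (w # v # omit j (us ss))))" if v: "v = l \<or> v = - l" for v w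
  proof -
    note lin = linear_gauge_B [of \<eta> \<xi> N s "q * t'" v]
    have "gauge_B \<eta> \<xi> N s (q * t') v f = (\<lambda>c. Kf * (\<Sum>ss\<in>sign_lists M. H ss * 
        gauge_B \<eta> \<xi> N s (q * t') v (gauge_B_list \<eta> \<xi> N (us ss) p (q * t' * t') R) c))"
      unfolding f linear_op_scale [OF lin] linear_op_sum [OF lin] ..
    also have "\<dots> = (\<lambda>c. Kf * (\<Sum>ss\<in>sign_lists M. H ss * 
      (\<kappa> * (D0 * a_fun N \<eta> \<xi> v * (\<Prod>i<M. ratio_minus \<eta> (v - us ss ! i)) *
       gauge_B_list \<eta> \<xi> N (us ss) (p * t) (q * t') R' c +
     sinh \<eta> * (\<Sum>j<M. (E0 + D0 * coth (v - us ss ! j)) * ec ss j *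
       gauge_B_list \<eta> \<xi> N (v # omit j (us ss)) (p * t) (q * t') R' c)))))"
      by (simp add: move v cong: sum.cong)
    finally have eq: "gauge_B \<eta> \<xi> N s (q * t') v f = \<dots>" .
    note lin = linear_gauge_B [of \<eta> \<xi> N p q w]
    show ?thesis
      unfolding eq linear_op_scale [OF lin] linear_op_sum [OF lin] linear_op_add [OF lin] G_def
        gauge_B_list.simps t_def [symmetric] t'_def [symmetric]
      by (simp add: sum_distrib_left sum.distrib algebra_simps)
  qed
  \<comment> \<open>Since the operators at l and -l may be interchanged, the unwanted terms for v =
    -l and v = l multiply the same vector. The difference of their coefficients is free of E0 and
    even in \<open>us ss ! j\<close>.\<close>
  have zero: "(\<Sum>ss\<in>sign_lists M. \<Sum>j<M. H ss * ec ss j *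
      (D0 * (coth (- l - us ss ! j) - coth (l - us ss ! j))) * G (l # - l # omit j (us ss))) = 0"
  proof (subst sum.swap, rule sum.neutral, intro ballI)
    fix j assume "j \<in> {..<M}"
    have "coth (- l - (- x)) - coth (l - (- x)) = coth (- l - x) - coth (l - x)" for x
      using sinh_minus [of "l + x"] sinh_minus [of "l - x"] cosh_minus [of "l + x"] cosh_minus [of "l - x"]
      by (simp add: coth_def algebra_simps)
    with \<open>j \<in> {..<M}\<close> show "(\<Sum>ss\<in>sign_lists M. H ss * ec ss j *
      (D0 * (coth (- l - us ss ! j) - coth (l - us ss ! j))) * G (l # - l # omit j (us ss))) = 0"
      unfolding H_def ec_def us_def
      by (intro sum_sign_lists_odd [where e = "\<lambda>x. D0 * (coth (- l - x) - coth (l - x))"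
            and V = "\<lambda>ws. G (l # - l # ws)"]) (simp_all add: M_def)
  qed
  have sl: "sinh (2 * l) \<noteq> 0" using Cons.prems(1) by simp
  \<comment> \<open>The relative minus sign of the antisymmetrisation is supplied by the factor 1 /
    sinh (2 u) of \<open>sign_coeff\<close> at u = l and u = -l.\<close>
  have direct: "sinh (2 * l) * (\<Sum>ss\<in>sign_lists (Suc M). sign_coeff N (map2 (*) ss (l # ls)) * G (map2 (*) ss (l # ls))) =
    (\<Sum>ss\<in>sign_lists M. H ss * (a_fun N \<eta> \<xi> (- l) * (\<Prod>i<M. ratio_minus \<eta> (- l - us ss ! i))) * G (l # us ss)) -
    (\<Sum>ss\<in>sign_lists M. H ss * (a_fun N \<eta> \<xi> l * (\<Prod>i<M. ratio_minus \<eta> (l - us ss ! i))) * G (- l # us ss))"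
  proof -
    have r: "ratio_minus \<eta> (- l - x) = ratio_plus \<eta> (l + x)" "ratio_minus \<eta> (l - x) = ratio_plus \<eta> (- l + x)" for x
      using ratio_plus_minus [of "l - x"] ratio_plus_minus [of "- l - x"] by (simp_all add: algebra_simps)
    have "sinh (2 * l) * (sign_coeff N (l # us ss) * G (l # us ss)) =
        H ss * (a_fun N \<eta> \<xi> (- l) * (\<Prod>i<M. ratio_minus \<eta> (- l - us ss ! i))) * G (l # us ss)"
      "sinh (2 * l) * (sign_coeff N (- l # us ss) * G (- l # us ss)) =
        - (H ss * (a_fun N \<eta> \<xi> l * (\<Prod>i<M. ratio_minus \<eta> (l - us ss ! i))) * G (- l # us ss))"
      if "ss \<in> sign_lists M" for ss
      unfolding sign_coeff.simps length_us [OF that] r H_def using sl by simp_all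
    then show ?thesis
      unfolding sum_sign_lists_Suc sum_distrib_left sum_subtractf [symmetric] distrib_left
      by (intro sum.cong) (simp_all add: us_def)
  qed
  have D0: "D0 \<noteq> 0" using Cons.prems(3) [of 0] by (simp add: D0_def t'_def)
  have "boundary_B_list N (l # ls) q (product_state \<eta> \<xi> N Q) c =
     (- 1) ^ N / (2 * q) * sinh (2 * l - \<eta>) / (sinh (2 * l) * D0) *
     (gauge_B \<eta> \<xi> N p q l (gauge_B \<eta> \<xi> N s (q * t') (- l) f) c -
      gauge_B \<eta> \<xi> N p q (- l) (gauge_B \<eta> \<xi> N s (q * t') l f) c)"
    using boundary_B_expansion [OF sl, of p s \<eta> \<xi> N q f c] D0
    by (simp add: D0_def f_def t'_def)
  also have "gauge_B \<eta> \<xi> N p q l (gauge_B \<eta> \<xi> N s (q * t') (- l) f) c -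
      gauge_B \<eta> \<xi> N p q (- l) (gauge_B \<eta> \<xi> N s (q * t') l f) c =
    Kf * \<kappa> * (D0 * (sinh (2 * l) * (\<Sum>ss\<in>sign_lists (Suc M).
        sign_coeff N (map2 (*) ss (l # ls)) * G (map2 (*) ss (l # ls)))) +
      sinh \<eta> * (\<Sum>ss\<in>sign_lists M. \<Sum>j<M. H ss * ec ss j *
      (D0 * (coth (- l - us ss ! j) - coth (l - us ss ! j))) * G (l # - l # omit j (us ss))))"
  proof -
    have swap: "G (- l # l # ws) = G (l # - l # ws)" for ws
      unfolding G_def by (subst gauge_B_list_swap) (rule refl)
    have diff: "Kf * \<kappa> * (D0 * A1 + sinh \<eta> * B1) - Kf * \<kappa> * (D0 * A2 + sinh \<eta> * B2) =
      Kf * \<kappa> * (D0 * (A1 - A2) + sinh \<eta> * (B1 - B2))" for A1 A2 B1 B2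
      by (simp add: algebra_simps)
    have "gauge_B \<eta> \<xi> N p q l (gauge_B \<eta> \<xi> N s (q * t') (- l) f) c -
        gauge_B \<eta> \<xi> N p q (- l) (gauge_B \<eta> \<xi> N s (q * t') l f) c =
      Kf * \<kappa> * (D0 * (sinh (2 * l) * (\<Sum>ss\<in>sign_lists (Suc M).
        sign_coeff N (map2 (*) ss (l # ls)) * G (map2 (*) ss (l # ls)))) +
      sinh \<eta> * ((\<Sum>ss\<in>sign_lists M. \<Sum>j<M. H ss * ec ss j *
           (E0 + D0 * coth (- l - us ss ! j)) * G (l # - l # omit j (us ss))) -
         (\<Sum>ss\<in>sign_lists M. \<Sum>j<M. H ss * ec ss j *
           (E0 + D0 * coth (l - us ss ! j)) * G (l # - l # omit j (us ss)))))"
      unfolding W [OF disjI1 [OF refl]] W [OF disjI2 [OF refl]] diff direct swap ..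
    also have "(\<Sum>ss\<in>sign_lists M. \<Sum>j<M. H ss * ec ss j *
           (E0 + D0 * coth (- l - us ss ! j)) * G (l # - l # omit j (us ss))) -
         (\<Sum>ss\<in>sign_lists M. \<Sum>j<M. H ss * ec ss j *
           (E0 + D0 * coth (l - us ss ! j)) * G (l # - l # omit j (us ss))) =
      (\<Sum>ss\<in>sign_lists M. \<Sum>j<M. H ss * ec ss j *
      (D0 * (coth (- l - us ss ! j) - coth (l - us ss ! j))) * G (l # - l # omit j (us ss)))"
      unfolding sum_subtractf [symmetric] by (intro sum.cong refl) (simp add: algebra_simps)
    finally show ?thesis .
  qed
  also have "(- 1) ^ N / (2 * q) * sinh (2 * l - \<eta>) / (sinh (2 * l) * D0) * \<dots> =
    (- 1) ^ N / (2 * q) * \<kappa> * Kf * sinh (2 * l - \<eta>) * (\<Sum>ss\<in>sign_lists (Suc M).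
        sign_coeff N (map2 (*) ss (l # ls)) * G (map2 (*) ss (l # ls)))"
    unfolding zero using sl D0 by simp
  finally show ?case
    by (simp add: Kf_def \<kappa>_def M_def G_def R'_def t_def t'_def mult_ac)
qed

end

section \<open>Matrices as operators on spin configurations\<close>

text \<open>Sites outside the chain carry False, in the same way as a number below 2^L has no binary
  digits from L on.\<close>

definition configs :: "nat \<Rightarrow> (nat \<Rightarrow> bool) set" where
  "configs L = {c. \<forall>m\<ge>L. \<not> c m}"

lemma site_digit_bit: "site_digit k i = of_bool (bit k i)"
  by (simp add: site_digit_def bit_iff_odd mod_2_eq_odd)

lemma bij_betw_bit_configs: "bij_betw bit {..<2 ^ L :: nat} (configs L)"
proof -
  have less: "k < 2 ^ L \<longleftrightarrow> bit k \<in> configs L" for k :: nat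
  proof
    assume "k < 2 ^ L"
    then have "take_bit L k = k" by (simp add: take_bit_nat_eq_self_iff)
    then have "bit k m \<longleftrightarrow> m < L \<and> bit k m" for m by (metis bit_take_bit_iff)
    then show "bit k \<in> configs L" unfolding configs_def by (auto simp: not_less[symmetric])
  next
    assume "bit k \<in> configs L"
    then have "take_bit L k = k"
      by (intro bit_eqI) (auto simp: bit_take_bit_iff configs_def not_le[symmetric])
    then show "k < 2 ^ L" by (simp add: take_bit_nat_eq_self_iff)
  qed
  moreover have "inj_on (bit :: nat \<Rightarrow> nat \<Rightarrow> bool) {..<2 ^ L}"
    by (rule inj_onI) (simp add: bit_eq_iff)
  moreover have "c \<in> bit ` {..<2 ^ L :: nat}" if c: "c \<in> configs L" for c
  proof -
    define k :: nat where "k = horner_sum of_bool 2 (map c [0..<L])"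
    have "bit k m = c m" for m
      using c by (cases "m < L") (simp_all add: k_def bit_horner_sum_bit_iff configs_def)
    then have "bit k = c" by (rule ext)
    with c less [of k] show ?thesis by force
  qed
  ultimately show ?thesis
    unfolding bij_betw_def by auto
qed

lemma sum_bit_configs: "(\<Sum>l<2 ^ L :: nat. F (bit l)) = (\<Sum>c\<in>configs L. F c)"
  by (rule sum.reindex_bij_betw [OF bij_betw_bit_configs])

lemma finite_configs: "finite (configs L)"
  using bij_betw_finite [OF bij_betw_bit_configs] by blast

lemma bit_in_configs: "k < 2 ^ L \<Longrightarrow> bit (k :: nat) \<in> configs L"
  using bij_betw_bit_configs by (auto simp: bij_betw_def)

text \<open>Entries of a site operator vanish unless row and column agree at all other sites, so a
  sum over columns reduces to one over the spin at that site.\<close>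

lemma sum_configs_agree1:
  fixes F :: "(nat \<Rightarrow> bool) \<Rightarrow> complex"
  assumes c: "c \<in> configs L" and i: "i < L"
  shows "(\<Sum>d\<in>configs L. if \<forall>m<L. m \<noteq> i \<longrightarrow> c m = d m then F d else 0) =
    (\<Sum>b\<in>UNIV. F (c(i := b)))"
proof -
  have eq: "{d \<in> configs L. \<forall>m<L. m \<noteq> i \<longrightarrow> c m = d m} = range (\<lambda>b. c(i := b))"
  proof (intro equalityI subsetI)
    fix d assume d: "d \<in> {d \<in> configs L. \<forall>m<L. m \<noteq> i \<longrightarrow> c m = d m}"
    have "d m = (c(i := d i)) m" for m
      using c d i by (cases "m < L") (auto simp: configs_def)
    then have "d = c(i := d i)" by (rule ext)
    then show "d \<in> range (\<lambda>b. c(i := b))" by (rule image_eqI) simp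
  next
    fix d assume "d \<in> range (\<lambda>b. c(i := b))"
    then obtain b where "d = c(i := b)" by blast
    then show "d \<in> {d \<in> configs L. \<forall>m<L. m \<noteq> i \<longrightarrow> c m = d m}"
      using c i unfolding configs_def by (simp add: fun_upd_apply)
  qed
  have inj: "inj (\<lambda>b. c(i := b))"
    by (rule injI) (metis fun_upd_same)
  show ?thesis
    unfolding sum.inter_filter [OF finite_configs, symmetric] eq
    by (simp add: sum.reindex [OF inj] del: UNIV_bool)
qed

lemma sum_configs_agree2:
  fixes F :: "(nat \<Rightarrow> bool) \<Rightarrow> complex"
  assumes c: "c \<in> configs L" and i: "i < L" "j < L" "i \<noteq> j"
  shows "(\<Sum>d\<in>configs L. if \<forall>m<L. m \<noteq> i \<and> m \<noteq> j \<longrightarrow> c m = d m then F d else 0) =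
    (\<Sum>b\<in>UNIV. \<Sum>t\<in>UNIV. F (c(i := b, j := t)))"
proof -
  have eq: "{d \<in> configs L. \<forall>m<L. m \<noteq> i \<and> m \<noteq> j \<longrightarrow> c m = d m} =
      (\<lambda>(b, t). c(i := b, j := t)) ` (UNIV \<times> UNIV)"
  proof (intro equalityI subsetI)
    fix d assume d: "d \<in> {d \<in> configs L. \<forall>m<L. m \<noteq> i \<and> m \<noteq> j \<longrightarrow> c m = d m}"
    have "d m = (c(i := d i, j := d j)) m" for m
      using c d i by (cases "m < L") (auto simp: configs_def)
    then have "d = c(i := d i, j := d j)" by (rule ext)
    then show "d \<in> (\<lambda>(b, t). c(i := b, j := t)) ` (UNIV \<times> UNIV)"
      by (intro image_eqI [of _ _ "(d i, d j)"]) simp_all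
  next
    fix d assume "d \<in> (\<lambda>(b, t). c(i := b, j := t)) ` (UNIV \<times> UNIV)"
    then obtain b t where "d = c(i := b, j := t)" by (metis (mono_tags, lifting) imageE case_prod_conv surj_pair)
    then show "d \<in> {d \<in> configs L. \<forall>m<L. m \<noteq> i \<and> m \<noteq> j \<longrightarrow> c m = d m}"
      using c i unfolding configs_def by (simp add: fun_upd_apply)
  qed
  have inj: "inj_on (\<lambda>(b, t). c(i := b, j := t)) (UNIV \<times> UNIV)"
  proof (rule inj_onI, clarify)
    fix b t b' t' assume "c(i := b, j := t) = c(i := b', j := t')"
    from fun_cong [OF this, of i] fun_cong [OF this, of j] show "b = b' \<and> t = t'"
      using i by simp
  qed
  show ?thesis
    unfolding sum.inter_filter [OF finite_configs, symmetric] eq sum.cartesian_product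
    by (subst sum.reindex [OF inj]) (simp add: case_prod_unfold comp_def)
qed

section \<open>Vectors of the chain, without and with the auxiliary space\<close>

definition state_vec :: "nat \<Rightarrow> state \<Rightarrow> complex vec" where
  "state_vec N f = vec (2 ^ N) (\<lambda>k. f (bit k))"

text \<open>The auxiliary spin is digit 0 of the long index. Hence the quantum site n is digit n
  there, but position n - 1 of the configuration passed to G.\<close>

definition aux_state_vec :: "nat \<Rightarrow> (bool \<Rightarrow> state) \<Rightarrow> complex vec" where
  "aux_state_vec N G = vec (2 ^ (N + 1)) (\<lambda>k. G (bit k 0) (\<lambda>i. bit k (Suc i)))"

lemma mult_mat_vec_sum:
  assumes "X \<in> carrier_mat m n" "i < m"
  shows "(X *\<^sub>v vec n h) $ i = (\<Sum>l<n. X $$ (i, l) * h l)"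
  using assms by (auto simp: scalar_prod_def lessThan_atLeast0 intro!: sum.cong)

lemma site_op2_aux_state_vec:
  assumes "1 \<le> n" "n \<le> N"
  shows "site_op2 (N + 1) 0 n R *\<^sub>v aux_state_vec N G =
    aux_state_vec N (\<lambda>a c. \<Sum>b\<in>UNIV. \<Sum>t\<in>UNIV.
      R $$ (2 * of_bool a + of_bool (c (n - 1)), 2 * of_bool b + of_bool t) * G b (c(n - 1 := t)))"
proof (rule eq_vecI)
  fix k assume "k < dim_vec (aux_state_vec N (\<lambda>a c. \<Sum>b\<in>UNIV. \<Sum>t\<in>UNIV.
      R $$ (2 * of_bool a + of_bool (c (n - 1)), 2 * of_bool b + of_bool t) * G b (c(n - 1 := t))))"
  then have k: "k < 2 ^ (N + 1)" by (simp add: aux_state_vec_def)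
  define F where "F d = R $$ (2 * of_bool (bit k 0) + of_bool (bit k n), 2 * of_bool (d 0) + of_bool (d n)) *
     G (d 0) (\<lambda>i. d (Suc i))" for d
  have "(site_op2 (N + 1) 0 n R *\<^sub>v aux_state_vec N G) $ k =
    (\<Sum>l<2 ^ (N + 1) :: nat. if \<forall>m<N + 1. m \<noteq> 0 \<and> m \<noteq> n \<longrightarrow> bit k m = bit l m then F (bit l) else 0)"
    unfolding aux_state_vec_def
    by (subst mult_mat_vec_sum [where m = "2 ^ (N + 1)"])
      (use k in \<open>auto simp: site_op2_def F_def site_digit_bit intro!: sum.cong\<close>)
  also have "\<dots> = (\<Sum>b\<in>UNIV. \<Sum>t\<in>UNIV. F ((bit k)(0 := b, n := t)))"
    unfolding sum_bit_configs [where F = "\<lambda>d. if \<forall>m<N + 1. m \<noteq> 0 \<and> m \<noteq> n \<longrightarrow> bit k m = d m then F d else 0"]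
    using assms k by (intro sum_configs_agree2 bit_in_configs) auto
  finally have sum: "(site_op2 (N + 1) 0 n R *\<^sub>v aux_state_vec N G) $ k =
    (\<Sum>b\<in>UNIV. \<Sum>t\<in>UNIV. F ((bit k)(0 := b, n := t)))" .
  have F_upd: "F ((bit k)(0 := b, n := t)) =
      R $$ (2 * of_bool (bit k 0) + of_bool (bit k n), 2 * of_bool b + of_bool t) *
      G b ((\<lambda>i. bit k (Suc i))(n - 1 := t))" for b t
  proof -
    have "(\<lambda>i. ((bit k)(0 := b, n := t)) (Suc i)) = (\<lambda>i. bit k (Suc i))(n - 1 := t)"
      using assms by (auto simp: fun_eq_iff)
    then show ?thesis unfolding F_def using assms by simp
  qed
  show "(site_op2 (N + 1) 0 n R *\<^sub>v aux_state_vec N G) $ k =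
      aux_state_vec N (\<lambda>a c. \<Sum>b\<in>UNIV. \<Sum>t\<in>UNIV.
      R $$ (2 * of_bool a + of_bool (c (n - 1)), 2 * of_bool b + of_bool t) * G b (c(n - 1 := t))) $ k"
    using k assms unfolding sum F_upd by (simp add: aux_state_vec_def)
qed (simp add: site_op2_def aux_state_vec_def)

lemma site_op1_aux_state_vec:
  "site_op1 (N + 1) 0 K *\<^sub>v aux_state_vec N G =
    aux_state_vec N (\<lambda>a c. \<Sum>b\<in>UNIV. K $$ (of_bool a, of_bool b) * G b c)"
proof (rule eq_vecI)
  fix k assume "k < dim_vec (aux_state_vec N (\<lambda>a c. \<Sum>b\<in>UNIV. K $$ (of_bool a, of_bool b) * G b c))"
  then have k: "k < 2 ^ (N + 1)" by (simp add: aux_state_vec_def)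
  define F where "F d = K $$ (of_bool (bit k 0), of_bool (d 0)) * G (d 0) (\<lambda>i. d (Suc i))" for d
  have "(site_op1 (N + 1) 0 K *\<^sub>v aux_state_vec N G) $ k =
    (\<Sum>l<2 ^ (N + 1) :: nat. if \<forall>m<N + 1. m \<noteq> 0 \<longrightarrow> bit k m = bit l m then F (bit l) else 0)"
    unfolding aux_state_vec_def
    by (subst mult_mat_vec_sum [where m = "2 ^ (N + 1)"])
      (use k in \<open>auto simp: site_op1_def F_def site_digit_bit intro!: sum.cong\<close>)
  also have "\<dots> = (\<Sum>b\<in>UNIV. F ((bit k)(0 := b)))"
    unfolding sum_bit_configs [where F = "\<lambda>d. if \<forall>m<N + 1. m \<noteq> 0 \<longrightarrow> bit k m = d m then F d else 0"]
    using k by (intro sum_configs_agree1 bit_in_configs) auto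
  finally show "(site_op1 (N + 1) 0 K *\<^sub>v aux_state_vec N G) $ k =
      aux_state_vec N (\<lambda>a c. \<Sum>b\<in>UNIV. K $$ (of_bool a, of_bool b) * G b c) $ k"
    using k by (simp add: aux_state_vec_def F_def)
qed (simp add: site_op1_def aux_state_vec_def)

lemma mat_list_prod_mult_vec:
  assumes "set Xs \<subseteq> carrier_mat d d" and "v \<in> carrier_vec d"
  shows "mat_list_prod d Xs *\<^sub>v v = foldr (*\<^sub>v) Xs v"
proof -
  have "mat_list_prod d Xs \<in> carrier_mat d d \<and> mat_list_prod d Xs *\<^sub>v v = foldr (*\<^sub>v) Xs v"
    using assms(1)
  proof (induction Xs)
    case Nil
    then show ?case using assms(2) by (simp add: mat_list_prod_def)
  next
    case (Cons X Xs)
    then have "X \<in> carrier_mat d d" "mat_list_prod d Xs \<in> carrier_mat d d"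
      "mat_list_prod d Xs *\<^sub>v v = foldr (*\<^sub>v) Xs v" by simp_all
    moreover have "mat_list_prod d (X # Xs) = X * mat_list_prod d Xs"
      by (simp add: mat_list_prod_def)
    ultimately show ?case
      using assms(2) by (simp add: assoc_mult_mat_vec [of _ d d _ d])
  qed
  then show ?thesis by blast
qed

lemma sum_lessThan_double:
  "(\<Sum>l<2 * (n::nat). h l) = (\<Sum>l<n. h (2 * l) + h (2 * l + 1) :: complex)"
  by (induction n) (simp_all add: algebra_simps)

text \<open>Contracts the auxiliary column index with the vector \<beta>; this is how gauge vectors
  enter the matrix side.\<close>

lemma mult_aux_state_vec:
  assumes "X \<in> carrier_mat (2 ^ (N + 1)) (2 ^ (N + 1))" and k: "k < 2 ^ N" and a: "a < 2"
  shows "(X *\<^sub>v aux_state_vec N (\<lambda>b c. \<beta> b * f c)) $ (2 * k + a) =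
    \<beta> False * (aux_entry N a 0 X *\<^sub>v state_vec N f) $ k +
    \<beta> True * (aux_entry N a 1 X *\<^sub>v state_vec N f) $ k"
proof -
  have bits: "bit (2 * l) 0 = False" "bit (Suc (2 * l)) 0 = True"
    "bit (2 * l) (Suc i) = bit l i" "bit (Suc (2 * l)) (Suc i) = bit l i" for l i :: nat
    by (simp_all add: bit_Suc bit_0)
  have "2 * k + a < 2 * 2 ^ N" using k a by linarith
  then have "(X *\<^sub>v aux_state_vec N (\<lambda>b c. \<beta> b * f c)) $ (2 * k + a) =
      (\<Sum>l<2 * 2 ^ N. X $$ (2 * k + a, l) * (\<beta> (bit l 0) * f (\<lambda>i. bit l (Suc i))))"
    using assms(1) unfolding aux_state_vec_def by (subst mult_mat_vec_sum) auto
  also have "\<dots> = (\<Sum>l<2 ^ N. X $$ (2 * k + a, 2 * l) * (\<beta> False * f (bit l)) +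
      X $$ (2 * k + a, Suc (2 * l)) * (\<beta> True * f (bit l)))"
    unfolding sum_lessThan_double by (simp add: bits)
  also have "\<dots> = \<beta> False * (aux_entry N a 0 X *\<^sub>v state_vec N f) $ k +
    \<beta> True * (aux_entry N a 1 X *\<^sub>v state_vec N f) $ k"
    unfolding state_vec_def
    by (subst (1 2) mult_mat_vec_sum [where m = "2 ^ N"])
      (use k in \<open>auto simp: aux_entry_def sum_distrib_left sum.distrib algebra_simps\<close>)
  finally show ?thesis .
qed

section \<open>R-matrix entries as vertex weights and their crossing symmetry\<close>

lemma R_bar_mat_weight:
  "R_bar_mat \<eta> w $$ (2 * of_bool a + of_bool s, 2 * of_bool b + of_bool t) = weight \<eta> w a s b t"
  using sinh_minus [of w] sinh_minus [of "w - \<eta>"]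
  by (cases a; cases b; cases s; cases t)
    (simp_all add: R_bar_mat_def R_mat_def weight_def mat_of_rows_list_def)

text \<open>The first equation only inverts the definition of the bulk R-matrix and serves the
  second monodromy matrix. The other one is crossing: transposition in the auxiliary space combined
  with a spin flip, up to signs.\<close>

lemma R_mat_weight:
  "R_mat \<eta> w $$ (2 * of_bool a + of_bool s, 2 * of_bool b + of_bool t) = - weight \<eta> (- w) a s b t"
  "R_mat \<eta> (w - \<eta>) $$ (2 * of_bool a + of_bool s, 2 * of_bool b + of_bool t) =
    (if a = b then 1 else - 1) * weight \<eta> w (\<not> b) s (\<not> a) t"
  using sinh_minus [of w] sinh_minus [of "w + \<eta>"]
  by (cases a; cases b; cases s; cases t;
      simp add: R_mat_def weight_def mat_of_rows_list_def)+

lemma sum_weight_lax: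
  "(\<Sum>t\<in>UNIV. weight \<eta> w a (c n) b t * f (c(n := t))) = lax \<eta> w n a b f c"
  by (simp add: lax_weight UNIV_bool)

section \<open>Monodromy matrices\<close>

lemma aux_state_vec_carrier [simp]: "aux_state_vec N G \<in> carrier_vec (2 ^ (N + 1))"
  and state_vec_carrier [simp]: "state_vec N f \<in> carrier_vec (2 ^ N)"
  by (simp_all add: aux_state_vec_def state_vec_def)

lemma site_op_carrier [simp]:
  "site_op1 L i K \<in> carrier_mat (2 ^ L) (2 ^ L)" "site_op2 L i j R \<in> carrier_mat (2 ^ L) (2 ^ L)"
  by (simp_all add: site_op1_def site_op2_def)

lemma aux_entry_carrier: "aux_entry N a b X \<in> carrier_mat (2 ^ N) (2 ^ N)"
  by (simp add: aux_entry_def)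

lemma mat_list_prod_carrier: "set Xs \<subseteq> carrier_mat d d \<Longrightarrow> mat_list_prod d Xs \<in> carrier_mat d d"
  by (induction Xs) (auto simp: mat_list_prod_def)

lemma monodromy_carrier:
  "monodromy_T N \<eta> \<xi> u \<in> carrier_mat (2 ^ (N + 1)) (2 ^ (N + 1))"
  "monodromy_T_hat N \<eta> \<xi> u \<in> carrier_mat (2 ^ (N + 1)) (2 ^ (N + 1))"
  "monodromy_M N \<eta> \<xi> u \<in> carrier_mat (2 ^ (N + 1)) (2 ^ (N + 1))"
  unfolding monodromy_T_def monodromy_T_hat_def monodromy_M_def
  by (intro mat_list_prod_carrier; auto simp: site_op2_def)+

lemma U_minus_carrier: "U_minus N \<eta> \<xi> u \<in> carrier_mat (2 ^ (N + 1)) (2 ^ (N + 1))"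
  unfolding U_minus_def
  by (rule mult_carrier_mat [OF mult_carrier_mat [OF monodromy_carrier(1) site_op_carrier(1)]
        monodromy_carrier(2)])

lemma mat_list_prod_site_op2:
  "mat_list_prod (2 ^ (N + 1)) (map (\<lambda>n. site_op2 (N + 1) 0 n (R n)) ns) *\<^sub>v aux_state_vec N G =
    foldr (*\<^sub>v) (map (\<lambda>n. site_op2 (N + 1) 0 n (R n)) ns) (aux_state_vec N G)"
  by (rule mat_list_prod_mult_vec) (auto simp: site_op2_def aux_state_vec_def)

context
  fixes \<eta> :: complex and \<xi> :: "nat \<Rightarrow> complex"
begin

lemma foldr_monodromy_M:
  "n \<le> N \<Longrightarrow> foldr (*\<^sub>v)
     (map (\<lambda>n. site_op2 (N + 1) 0 n (R_bar_mat \<eta> (u - \<xi> n + \<eta> / 2))) (rev [1..<n + 1]))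
     (aux_state_vec N G) = aux_state_vec N (monodromy_act \<eta> \<xi> n u G)"
proof (induction n)
  case (Suc n)
  have "rev [1..<Suc n + 1] = Suc n # rev [1..<n + 1]" by simp
  then have "foldr (*\<^sub>v)
     (map (\<lambda>n. site_op2 (N + 1) 0 n (R_bar_mat \<eta> (u - \<xi> n + \<eta> / 2))) (rev [1..<Suc n + 1]))
     (aux_state_vec N G) = site_op2 (N + 1) 0 (Suc n) (R_bar_mat \<eta> (u - \<xi> (Suc n) + \<eta> / 2)) *\<^sub>v
       aux_state_vec N (monodromy_act \<eta> \<xi> n u G)"
    using Suc by (simp only: list.map foldr.simps comp_apply Suc_leD)
  also have "\<dots> = aux_state_vec N (monodromy_act \<eta> \<xi> (Suc n) u G)"
    by (subst site_op2_aux_state_vec)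
      (use Suc.prems in \<open>simp_all add: R_bar_mat_weight sum_weight_lax\<close>)
  finally show ?case .
qed simp

text \<open>The arguments are opposite, -(u + \<xi>_n - \<eta>/2) = -u - \<xi>_n + \<eta>/2, and the
  sites come in the same order as in the bulk monodromy matrix, so each site contributes just a
  factor -1.\<close>

lemma foldr_monodromy_T_hat:
  "n \<le> N \<Longrightarrow> foldr (*\<^sub>v)
     (map (\<lambda>n. site_op2 (N + 1) 0 n (R_mat \<eta> (u + \<xi> n - \<eta> / 2))) (rev [1..<n + 1]))
     (aux_state_vec N G) = aux_state_vec N (\<lambda>a c. (- 1) ^ n * monodromy_act \<eta> \<xi> n (- u) G a c)"
proof (induction n)
  case (Suc n)
  have "rev [1..<Suc n + 1] = Suc n # rev [1..<n + 1]" by simp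
  then have "foldr (*\<^sub>v)
     (map (\<lambda>n. site_op2 (N + 1) 0 n (R_mat \<eta> (u + \<xi> n - \<eta> / 2))) (rev [1..<Suc n + 1]))
     (aux_state_vec N G) = site_op2 (N + 1) 0 (Suc n) (R_mat \<eta> (u + \<xi> (Suc n) - \<eta> / 2)) *\<^sub>v
       aux_state_vec N (\<lambda>a c. (- 1) ^ n * monodromy_act \<eta> \<xi> n (- u) G a c)"
    using Suc by (simp only: list.map foldr.simps comp_apply Suc_leD)
  also have "\<dots> = aux_state_vec N (\<lambda>a c. (- 1) ^ Suc n * monodromy_act \<eta> \<xi> (Suc n) (- u) G a c)"
  proof -
    have arg: "- (u + \<xi> (Suc n) - \<eta> / 2) = - u - \<xi> (Suc n) + \<eta> / 2" by simp
    have sum: "(\<Sum>t\<in>UNIV. - weight \<eta> w a (c n) b t * ((- 1) ^ n * f (c(n := t)))) =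
      (- 1) ^ Suc n * lax \<eta> w n a b f c" for w a b c f
      unfolding sum_weight_lax [symmetric] by (simp add: UNIV_bool algebra_simps)
    have n: "1 \<le> Suc n" "Suc n \<le> N" using Suc.prems by simp_all
    show ?thesis
      unfolding site_op2_aux_state_vec [OF n] R_mat_weight(1) diff_Suc_1 arg sum
        monodromy_act.simps sum_distrib_left ..
  qed
  finally show ?case .
qed simp

(* Crossing: the entry (a, b) of R(w - \<eta>) is, up to a sign, the entry (not b, not a) of R_bar(w). *)
primrec monodromy_T_act :: "nat \<Rightarrow> complex \<Rightarrow> (bool \<Rightarrow> state) \<Rightarrow> bool \<Rightarrow> state" where
  "monodromy_T_act 0 u G = G"
| "monodromy_T_act (Suc N) u G = monodromy_T_act N u (\<lambda>a c. \<Sum>b\<in>UNIV.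
     (if a = b then 1 else - 1) * lax \<eta> (u - \<xi> (Suc N) + \<eta> / 2) N (\<not> b) (\<not> a) (G b) c)"

lemma foldr_monodromy_T:
  "n \<le> N \<Longrightarrow> foldr (*\<^sub>v)
     (map (\<lambda>n. site_op2 (N + 1) 0 n (R_mat \<eta> (u - \<xi> n - \<eta> / 2))) [1..<n + 1])
     (aux_state_vec N G) = aux_state_vec N (monodromy_T_act n u G)"
proof (induction n arbitrary: G)
  case (Suc n)
  have "[1..<Suc n + 1] = [1..<n + 1] @ [Suc n]" by simp
  then have "foldr (*\<^sub>v)
     (map (\<lambda>n. site_op2 (N + 1) 0 n (R_mat \<eta> (u - \<xi> n - \<eta> / 2))) [1..<Suc n + 1])
     (aux_state_vec N G) = foldr (*\<^sub>v)
     (map (\<lambda>n. site_op2 (N + 1) 0 n (R_mat \<eta> (u - \<xi> n - \<eta> / 2))) [1..<n + 1])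
     (site_op2 (N + 1) 0 (Suc n) (R_mat \<eta> (u - \<xi> (Suc n) - \<eta> / 2)) *\<^sub>v aux_state_vec N G)"
    by (simp only: map_append list.map foldr_append foldr.simps comp_apply id_apply)
  also have "site_op2 (N + 1) 0 (Suc n) (R_mat \<eta> (u - \<xi> (Suc n) - \<eta> / 2)) *\<^sub>v aux_state_vec N G =
    aux_state_vec N (\<lambda>a c. \<Sum>b\<in>UNIV.
     (if a = b then 1 else - 1) * lax \<eta> (u - \<xi> (Suc n) + \<eta> / 2) n (\<not> b) (\<not> a) (G b) c)"
  proof -
    have arg: "u - \<xi> (Suc n) - \<eta> / 2 = (u - \<xi> (Suc n) + \<eta> / 2) - \<eta>" by simp
    have sum: "(\<Sum>t\<in>UNIV. (if a = b then 1 else - 1) * weight \<eta> w (\<not> b) (c n) (\<not> a) t * f (c(n := t))) =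
      (if a = b then 1 else - 1) * lax \<eta> w n (\<not> b) (\<not> a) f c" for w a b c f
      unfolding sum_weight_lax [symmetric] by (simp add: UNIV_bool algebra_simps)
    have n: "1 \<le> Suc n" "Suc n \<le> N" using Suc.prems by simp_all
    show ?thesis
      unfolding site_op2_aux_state_vec [OF n] arg R_mat_weight(2) diff_Suc_1 sum ..
  qed
  finally show ?case
    using Suc by (simp only: Suc_leD monodromy_T_act.simps)
qed simp

text \<open>Crossing turns rows into columns: the covector (-1, q e^(-u)) on the left of T is the
  gauge vector (q, e^u) on the right of the bulk monodromy matrix, up to the factor e^(-u) and a
  spin flip. The last site acts first in T, so G must be arbitrary in the induction.\<close>

lemma monodromy_T_act_contraction:
  "exp (- u) * q * monodromy_T_act N u G True c - monodromy_T_act N u G False c =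
    exp (- u) * (gauge_col \<eta> \<xi> N q u False (G True) c - gauge_col \<eta> \<xi> N q u True (G False) c)"
proof (induction N arbitrary: G)
  case 0
  show ?case by (simp add: gauge_col_0 algebra_simps exp_minus_inverse mult_exp_exp)
next
  case (Suc N)
  note lin = linear_gauge_col [of \<eta> \<xi> N q u]
  show ?case
    unfolding monodromy_T_act.simps Suc
    by (simp add: UNIV_bool gauge_col_Suc gauge_col_lax_commute linear_op_add [OF lin]
        linear_op_diff [OF lin] algebra_simps)
qed

text \<open>The four coefficients form a matrix of rank one: the covector (-1, p e^(-u)) stands on
  the left of the monodromy matrix and the vector (q, e^u) on its right.\<close>

lemma B_bulk_state_vec:
  "B_bulk N \<eta> \<xi> u x y *\<^sub>v state_vec N f =
    state_vec N (gauge_B \<eta> \<xi> N (exp (- \<eta> / 2 - \<eta> * x)) (exp (- \<eta> / 2 - \<eta> * y)) u f)"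
proof (rule eq_vecI)
  fix k assume "k < dim_vec (state_vec N (gauge_B \<eta> \<xi> N (exp (- \<eta> / 2 - \<eta> * x)) (exp (- \<eta> / 2 - \<eta> * y)) u f))"
  then have k: "k < 2 ^ N" by (simp add: state_vec_def)
  have entries: "(X *\<^sub>v state_vec N f) $ k = (\<Sum>l<2 ^ N. X $$ (k, l) * f (bit l))"
    if "X \<in> carrier_mat (2 ^ N) (2 ^ N)" for X
    unfolding state_vec_def by (rule mult_mat_vec_sum [OF that k])
  define p q where "p = exp (- \<eta> / 2 - \<eta> * x)" and "q = exp (- \<eta> / 2 - \<eta> * y)"
  define E where "E a b = (aux_entry N a b (monodromy_M N \<eta> \<xi> u) *\<^sub>v state_vec N f) $ k" for a b
  have M: "monodromy_M N \<eta> \<xi> u *\<^sub>v aux_state_vec N G = aux_state_vec N (monodromy_act \<eta> \<xi> N u G)" for G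
    unfolding monodromy_M_def mat_list_prod_site_op2 by (rule foldr_monodromy_M) simp
  have col: "gauge_col \<eta> \<xi> N q u (a = 1) f (bit k) = q * E a 0 + exp u * E a 1" if "a < 2" for a
  proof -
    have "gauge_col \<eta> \<xi> N q u (a = 1) f (bit k) =
       (monodromy_M N \<eta> \<xi> u *\<^sub>v aux_state_vec N (\<lambda>b c. (if b then exp u else q) * f c)) $ (2 * k + a)"
      unfolding M gauge_col_def using k that
      by (cases a) (auto simp: aux_state_vec_def bit_0 bit_Suc less_Suc_eq)
    then show ?thesis
      using mult_aux_state_vec [OF monodromy_carrier(3) k that, of \<eta> \<xi> u "\<lambda>b. if b then exp u else q" f]
      by (simp add: E_def)
  qed
  have exps: "exp (- u - \<eta> / 2 - \<eta> * y) = exp (- u) * q" "exp (- u - \<eta> / 2 - \<eta> * x) = exp (- u) * p"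
    "exp (- 2 * u - \<eta> - \<eta> * (x + y)) = exp (- u) * exp (- u) * p * q"
    unfolding p_def q_def by (simp_all flip: exp_add add: algebra_simps)
  have "(B_bulk N \<eta> \<xi> u x y *\<^sub>v state_vec N f) $ k =
      - exp u * (E 0 1 + exp (- u) * q * E 0 0 - exp (- u) * exp (- u) * p * q * E 1 0 - exp (- u) * p * E 1 1)"
  proof -
    have E: "E a b = (\<Sum>l<2 ^ N. monodromy_M N \<eta> \<xi> u $$ (2 * k + a, 2 * l + b) * f (bit l))" for a b
      unfolding E_def by (subst entries) (use k in \<open>auto simp: aux_entry_def\<close>)
    have "(B_bulk N \<eta> \<xi> u x y *\<^sub>v state_vec N f) $ k = (\<Sum>l<2 ^ N. B_bulk N \<eta> \<xi> u x y $$ (k, l) * f (bit l))"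
      by (rule entries)
        (unfold B_bulk_def Let_def, intro smult_carrier_mat minus_carrier_mat aux_entry_carrier)
    also have "\<dots> = (\<Sum>l<2 ^ N. - exp u * (monodromy_M N \<eta> \<xi> u $$ (2 * k + 0, 2 * l + 1) +
        exp (- u) * q * monodromy_M N \<eta> \<xi> u $$ (2 * k + 0, 2 * l + 0) -
        exp (- u) * exp (- u) * p * q * monodromy_M N \<eta> \<xi> u $$ (2 * k + 1, 2 * l + 0) -
        exp (- u) * p * monodromy_M N \<eta> \<xi> u $$ (2 * k + 1, 2 * l + 1)) * f (bit l))"
      unfolding B_bulk_def Let_def exps
      by (rule sum.cong [OF refl]) (use k in \<open>simp add: aux_entry_def\<close>)
    finally show ?thesis
      unfolding E sum_distrib_left sum.distrib [symmetric] sum_subtractf [symmetric]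
      by (rule trans) (rule sum.cong [OF refl], simp only: algebra_simps)
  qed
  also have "\<dots> = gauge_B \<eta> \<xi> N p q u f (bit k)"
    unfolding gauge_B_def using col [of 0] col [of 1]
    by (simp add: exp_minus field_simps)
  finally show "(B_bulk N \<eta> \<xi> u x y *\<^sub>v state_vec N f) $ k =
      state_vec N (gauge_B \<eta> \<xi> N (exp (- \<eta> / 2 - \<eta> * x)) (exp (- \<eta> / 2 - \<eta> * y)) u f) $ k"
    using k by (simp add: state_vec_def p_def q_def)
qed (simp add: B_bulk_def Let_def aux_entry_def state_vec_def)

text \<open>Here, too, the four coefficients have rank one. The covector (-1, q e^(-u)) on the left
  is the one that crossing can handle, and the vector on the right is a gauge vector for the
  spectral parameter -u.\<close>

lemma B_hat_state_vec:
  "B_hat N \<eta> \<xi> u z *\<^sub>v state_vec N f = state_vec N (boundary_B \<eta> \<xi> N (exp (\<eta> / 2 - \<eta> * z)) u f)"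
proof (rule eq_vecI)
  fix k assume "k < dim_vec (state_vec N (boundary_B \<eta> \<xi> N (exp (\<eta> / 2 - \<eta> * z)) u f))"
  then have k: "k < 2 ^ N" by (simp add: state_vec_def)
  have entries: "(X *\<^sub>v state_vec N f) $ k = (\<Sum>l<2 ^ N. X $$ (k, l) * f (bit l))"
    if "X \<in> carrier_mat (2 ^ N) (2 ^ N)" for X
    unfolding state_vec_def by (rule mult_mat_vec_sum [OF that k])
  define q where "q = exp (\<eta> / 2 - \<eta> * z)"
  define E where "E a b = (aux_entry N a b (U_minus N \<eta> \<xi> u) *\<^sub>v state_vec N f) $ k" for a b
  define Y where "Y a = gauge_col \<eta> \<xi> N (q * exp (- \<eta>)) (- u) a f" for a
  define G where "G = (\<lambda>a c. (if a then exp (u - \<eta> / 2) else exp (\<eta> / 2 - u)) *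
      ((- 1) ^ N * (exp (u + \<eta> * z) * Y a c)))"
  define \<beta> where "\<beta> b = (if b then exp (\<eta> * z) else exp (u - \<eta> / 2))" for b
  have T_hat: "monodromy_T_hat N \<eta> \<xi> u *\<^sub>v aux_state_vec N (\<lambda>b c. \<beta> b * f c) =
      aux_state_vec N (\<lambda>a c. (- 1) ^ N * (exp (u + \<eta> * z) * Y a c))"
  proof -
    have hat: "monodromy_T_hat N \<eta> \<xi> u *\<^sub>v aux_state_vec N H =
        aux_state_vec N (\<lambda>a c. (- 1) ^ N * monodromy_act \<eta> \<xi> N (- u) H a c)" for H
      unfolding monodromy_T_hat_def mat_list_prod_site_op2 by (rule foldr_monodromy_T_hat) simp
    \<comment> \<open>Up to the scalar e^(u + \<eta> z), the right vector is the gauge vector at -u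
      with parameter q e^(-\<eta>), so the two columns have the consecutive gauge parameters
      required by the exchange relations.\<close>
    have \<beta>: "(\<lambda>b c. \<beta> b * f c) = (\<lambda>b c. (if b then exp (- u) else q * exp (- \<eta>)) * (exp (u + \<eta> * z) * f c))"
      by (auto simp: \<beta>_def q_def fun_eq_iff mult_exp_exp mult.assoc [symmetric])
    show ?thesis
      unfolding \<beta> hat gauge_col_def [symmetric] linear_op_scale [OF linear_gauge_col] Y_def ..
  qed
  have K: "site_op1 (N + 1) 0 (K_minus \<eta> u) *\<^sub>v aux_state_vec N H =
      aux_state_vec N (\<lambda>a c. (if a then exp (u - \<eta> / 2) else exp (\<eta> / 2 - u)) * H a c)" for H
    unfolding site_op1_aux_state_vec K_minus_diag
    by (rule arg_cong [where f = "aux_state_vec N"])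
      (auto simp: fun_eq_iff UNIV_bool mat_of_rows_list_def)
  have T: "monodromy_T N \<eta> \<xi> u *\<^sub>v aux_state_vec N H = aux_state_vec N (monodromy_T_act N u H)" for H
    unfolding monodromy_T_def mat_list_prod_site_op2 by (rule foldr_monodromy_T) simp
  have U: "U_minus N \<eta> \<xi> u *\<^sub>v aux_state_vec N (\<lambda>b c. \<beta> b * f c) = aux_state_vec N (monodromy_T_act N u G)"
    unfolding U_minus_def G_def K [symmetric] T [symmetric] T_hat [symmetric]
    by (subst assoc_mult_mat_vec [of _ "2 ^ (N + 1)" "2 ^ (N + 1)" _ "2 ^ (N + 1)"],
        rule mult_carrier_mat [OF monodromy_carrier(1) site_op_carrier(1)],
        rule monodromy_carrier, rule aux_state_vec_carrier,
        rule assoc_mult_mat_vec [OF monodromy_carrier(1) site_op_carrier(1)],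
        rule mult_mat_vec_carrier [OF monodromy_carrier(2) aux_state_vec_carrier])
  have act: "monodromy_T_act N u G (a = 1) (bit k) = exp (u - \<eta> / 2) * E a 0 + exp (\<eta> * z) * E a 1"
    if "a < 2" for a
  proof -
    have "monodromy_T_act N u G (a = 1) (bit k) =
       (U_minus N \<eta> \<xi> u *\<^sub>v aux_state_vec N (\<lambda>b c. \<beta> b * f c)) $ (2 * k + a)"
      unfolding U using k that
      by (cases a) (auto simp: aux_state_vec_def bit_0 bit_Suc less_Suc_eq)
    then show ?thesis
      using mult_aux_state_vec [OF U_minus_carrier k that, of \<eta> \<xi> u \<beta> f]
      by (simp add: E_def \<beta>_def)
  qed
  have "(B_hat N \<eta> \<xi> u z *\<^sub>v state_vec N f) $ k = 1 / 2 * (exp (- \<eta> * z) * E 1 0 - exp (\<eta> * z) * E 0 1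
      + exp (\<eta> / 2 - u) * E 1 1 - exp (u - \<eta> / 2) * E 0 0)"
  proof -
    have E: "E a b = (\<Sum>l<2 ^ N. U_minus N \<eta> \<xi> u $$ (2 * k + a, 2 * l + b) * f (bit l))" for a b
      unfolding E_def by (subst entries) (use k in \<open>auto simp: aux_entry_def\<close>)
    have "(B_hat N \<eta> \<xi> u z *\<^sub>v state_vec N f) $ k = (\<Sum>l<2 ^ N. B_hat N \<eta> \<xi> u z $$ (k, l) * f (bit l))"
      by (rule entries)
        (unfold B_hat_def Let_def, intro smult_carrier_mat minus_carrier_mat aux_entry_carrier)
    also have "\<dots> = (\<Sum>l<2 ^ N. 1 / 2 * (exp (- \<eta> * z) * U_minus N \<eta> \<xi> u $$ (2 * k + 1, 2 * l + 0) -
        exp (\<eta> * z) * U_minus N \<eta> \<xi> u $$ (2 * k + 0, 2 * l + 1) +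
        exp (\<eta> / 2 - u) * U_minus N \<eta> \<xi> u $$ (2 * k + 1, 2 * l + 1) -
        exp (u - \<eta> / 2) * U_minus N \<eta> \<xi> u $$ (2 * k + 0, 2 * l + 0)) * f (bit l))"
      unfolding B_hat_def Let_def
      by (rule sum.cong [OF refl]) (use k in \<open>simp add: aux_entry_def\<close>)
    finally show ?thesis
      unfolding E sum_distrib_left sum.distrib [symmetric] sum_subtractf [symmetric]
      by (rule trans) (rule sum.cong [OF refl], simp only: algebra_simps)
  qed
  also have "\<dots> = 1 / 2 * (exp (- u) * q * monodromy_T_act N u G True (bit k) -
      monodromy_T_act N u G False (bit k))"
  proof -
    have "exp (- u) * q * exp (u - \<eta> / 2) = exp (- \<eta> * z)" "exp (- u) * q * exp (\<eta> * z) = exp (\<eta> / 2 - u)"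
      unfolding q_def mult_exp_exp by simp_all
    then have eq: "exp (- \<eta> * z) * E 1 0 + exp (\<eta> / 2 - u) * E 1 1 =
        exp (- u) * q * (exp (u - \<eta> / 2) * E 1 0 + exp (\<eta> * z) * E 1 1)"
      unfolding distrib_left mult.assoc [symmetric] by simp
    have act0: "monodromy_T_act N u G False (bit k) = exp (u - \<eta> / 2) * E 0 0 + exp (\<eta> * z) * E 0 1"
      using act [of 0] by simp
    have act1: "monodromy_T_act N u G True (bit k) = exp (u - \<eta> / 2) * E 1 0 + exp (\<eta> * z) * E 1 1"
      using act [of 1] by simp
    show ?thesis
      unfolding act0 act1 eq [symmetric] by (simp only: algebra_simps)
  qed
  also have "\<dots> = boundary_B \<eta> \<xi> N q u f (bit k)"
  proof -
    note scale = linear_op_scale [OF linear_gauge_col [of \<eta> \<xi> N q u]]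
    have factor: "exp (- u) * exp (u - \<eta> / 2) * exp (u + \<eta> * z) = exp u * exp (\<eta> * z - \<eta> / 2)"
      "exp (- u) * exp (\<eta> / 2 - u) * exp (u + \<eta> * z) = exp (\<eta> - u) * exp (\<eta> * z - \<eta> / 2)"
      unfolding mult_exp_exp by (rule arg_cong [where f = exp], simp add: field_simps)+
    have half: "1 / 2 * (exp (- u) * exp (u - \<eta> / 2) * exp (u + \<eta> * z)) = exp u / (2 * q)"
      "1 / 2 * (exp (- u) * exp (\<eta> / 2 - u) * exp (u + \<eta> * z)) = exp (\<eta> - u) / (2 * q)"
      unfolding factor
    proof -
      have "q * exp (\<eta> * z - \<eta> / 2) = 1" unfolding q_def mult_exp_exp by simp
      then have iq: "exp (\<eta> * z - \<eta> / 2) = 1 / q"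
        by (metis mult_zero_left nonzero_mult_div_cancel_left one_neq_zero)
      show "1 / 2 * (exp u * exp (\<eta> * z - \<eta> / 2)) = exp u / (2 * q)"
        "1 / 2 * (exp (\<eta> - u) * exp (\<eta> * z - \<eta> / 2)) = exp (\<eta> - u) / (2 * q)"
        unfolding iq by simp_all
    qed
    have regroup: "1 / 2 * (x * (k * (s * (e * A)) - k' * (s * (e * B)))) =
        s * ((1 / 2 * (x * k * e)) * A - (1 / 2 * (x * k' * e)) * B)" for x k k' s e A B :: complex
      by (simp add: algebra_simps)
    show ?thesis
      unfolding monodromy_T_act_contraction G_def boundary_B_def scale if_True if_False regroup half Y_def
      by (simp add: right_diff_distrib)
  qed
  finally show "(B_hat N \<eta> \<xi> u z *\<^sub>v state_vec N f) $ k =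
      state_vec N (boundary_B \<eta> \<xi> N (exp (\<eta> / 2 - \<eta> * z)) u f) $ k"
    using k by (simp add: state_vec_def q_def)
qed (simp add: B_hat_def Let_def aux_entry_def state_vec_def)

end

section \<open>The theorem\<close>

lemma exp_minus_exp_sinh:
  fixes a b :: complex
  shows "exp a - exp b = 2 * exp ((a + b) / 2) * sinh ((a - b) / 2)"
proof -
  have "exp ((a + b) / 2) * exp ((a - b) / 2) = exp a" "exp ((a + b) / 2) * exp (- ((a - b) / 2)) = exp b"
    unfolding mult_exp_exp by (rule arg_cong [where f = exp], simp add: field_simps)+
  moreover have "2 * r * ((s - t) / 2) = r * s - r * t" for r s t :: complex
    by (simp add: field_simps)
  ultimately show ?thesis
    by (simp only: sinh_field_def)
qed

lemma ref_state_product_state: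
  "ref_state N \<eta> \<xi> y = state_vec N (product_state \<eta> \<xi> N (exp (\<eta> * (of_nat N - y))))"
proof -
  have "exp (- (of_nat n - of_nat N + y) * \<eta> - \<xi> n) =
      exp (\<eta> * (of_nat N - y)) * exp (- (of_nat n * \<eta>) - \<xi> n)" for n
    unfolding mult_exp_exp by (rule arg_cong [where f = exp]) (simp add: algebra_simps)
  then show ?thesis
    unfolding ref_state_def state_vec_def product_state_def site_digit_bit
    by (intro arg_cong [where f = "vec _"] ext prod.cong) simp_all
qed

lemma foldr_B_hat:
  "foldr (*\<^sub>v) (map (\<lambda>j. B_hat N \<eta> \<xi> (\<mu> j) (w + 2 * (of_nat j - 1))) [a..<b]) (state_vec N f) =
    state_vec N (boundary_B_list \<eta> \<xi> N (map \<mu> [a..<b]) (exp (\<eta> / 2 - \<eta> * (w + 2 * (of_nat a - 1)))) f)"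
proof (induction "b - a" arbitrary: a)
  case (Suc n)
  then have ab: "[a..<b] = a # [Suc a..<b]" by (simp add: upt_conv_Cons)
  have q: "exp (\<eta> / 2 - \<eta> * (w + 2 * (of_nat a - 1))) * exp (- \<eta>) * exp (- \<eta>) =
      exp (\<eta> / 2 - \<eta> * (w + 2 * (of_nat (Suc a) - 1)))"
    unfolding mult_exp_exp by (rule arg_cong [where f = exp]) (simp add: algebra_simps)
  show ?case
    unfolding ab list.map foldr.simps comp_apply boundary_B_list.simps q
    by (subst Suc.hyps(1)) (use Suc.hyps(2) in \<open>simp_all add: B_hat_state_vec\<close>)
qed simp

lemma foldr_B_bulk:
  "foldr (*\<^sub>v) (map (\<lambda>j. B_bulk N \<eta> \<xi> (\<mu> j) (w - (of_nat j - 1)) (z + (of_nat j - 1))) [a..<b])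
     (state_vec N f) =
    state_vec N (gauge_B_list \<eta> \<xi> N (map \<mu> [a..<b]) (exp (- \<eta> / 2 - \<eta> * (w - (of_nat a - 1))))
      (exp (- \<eta> / 2 - \<eta> * (z + (of_nat a - 1)))) f)"
proof (induction "b - a" arbitrary: a)
  case (Suc n)
  then have ab: "[a..<b] = a # [Suc a..<b]" by (simp add: upt_conv_Cons)
  have pq: "exp (- \<eta> / 2 - \<eta> * (w - (of_nat a - 1))) * exp \<eta> =
      exp (- \<eta> / 2 - \<eta> * (w - (of_nat (Suc a) - 1)))"
    "exp (- \<eta> / 2 - \<eta> * (z + (of_nat a - 1))) * exp (- \<eta>) =
      exp (- \<eta> / 2 - \<eta> * (z + (of_nat (Suc a) - 1)))"
    unfolding mult_exp_exp by (rule arg_cong [where f = exp], simp add: algebra_simps)+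
  show ?case
    unfolding ab list.map foldr.simps comp_apply gauge_B_list.simps pq
    by (subst Suc.hyps(1)) (use Suc.hyps(2) in \<open>simp_all add: B_bulk_state_vec\<close>)
qed simp

lemma B_hat_prod_state_vec:
  "B_hat_prod N \<eta> \<xi> M \<mu> w *\<^sub>v state_vec N f =
    state_vec N (boundary_B_list \<eta> \<xi> N (map \<mu> [1..<M + 1]) (exp (\<eta> / 2 - \<eta> * w)) f)"
proof -
  have "B_hat N \<eta> \<xi> u z \<in> carrier_mat (2 ^ N) (2 ^ N)" for u z
    unfolding B_hat_def Let_def by (intro smult_carrier_mat minus_carrier_mat aux_entry_carrier)
  then show ?thesis
    using foldr_B_hat [of N \<eta> \<xi> \<mu> w 1 "M + 1" f]
    unfolding B_hat_prod_def by (subst mat_list_prod_mult_vec) auto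
qed

lemma B_bulk_prod_state_vec:
  "B_bulk_prod N \<eta> \<xi> M \<mu> w z *\<^sub>v state_vec N f =
    state_vec N (gauge_B_list \<eta> \<xi> N (map \<mu> [1..<M + 1]) (exp (- \<eta> / 2 - \<eta> * w)) (exp (- \<eta> / 2 - \<eta> * z)) f)"
proof -
  have "B_bulk N \<eta> \<xi> u x y \<in> carrier_mat (2 ^ N) (2 ^ N)" for u x y
    unfolding B_bulk_def Let_def by (intro smult_carrier_mat minus_carrier_mat aux_entry_carrier)
  then show ?thesis
    using foldr_B_bulk [of N \<eta> \<xi> \<mu> w z 1 "M + 1" f]
    unfolding B_bulk_prod_def by (subst mat_list_prod_mult_vec) auto
qed

section \<open>Coefficients of the expansion in closed form\<close>

lemma sum_PiE_sign_lists:
  "(\<Sum>\<sigma>\<in>{1..M} \<rightarrow>\<^sub>E {1, - 1}. F (map \<sigma> [1..<M + 1])) = (\<Sum>ss\<in>sign_lists M. F ss)"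
proof (rule sum.reindex_bij_witness [where j = "\<lambda>\<sigma>. map \<sigma> [1..<M + 1]"
      and i = "\<lambda>ss. \<lambda>j\<in>{1..M}. ss ! (j - 1)"])
  fix \<sigma> :: "nat \<Rightarrow> complex" assume \<sigma>: "\<sigma> \<in> {1..M} \<rightarrow>\<^sub>E {1, - 1}"
  show "(\<lambda>j\<in>{1..M}. map \<sigma> [1..<M + 1] ! (j - 1)) = \<sigma>"
  proof (rule ext)
    show "(\<lambda>j\<in>{1..M}. map \<sigma> [1..<M + 1] ! (j - 1)) j = \<sigma> j" for j
      using PiE_arb [OF \<sigma>, of j] by (cases "j \<in> {1..M}") (auto simp: nth_append simp del: upt_Suc)
  qed
  show "map \<sigma> [1..<M + 1] \<in> sign_lists M"
    using \<sigma> by (auto simp: sign_lists_def PiE_iff simp del: upt_Suc)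
next
  fix ss assume ss: "ss \<in> sign_lists M"
  show "map (\<lambda>j\<in>{1..M}. ss ! (j - 1)) [1..<M + 1] = ss"
    using ss by (intro nth_equalityI) (auto simp: sign_lists_def simp del: upt_Suc)
  have "ss ! (j - 1) \<in> {1, - 1}" if "j \<in> {1..M}" for j
  proof -
    have "ss ! (j - 1) \<in> set ss" using ss that by (intro nth_mem) (auto simp: sign_lists_def)
    then show ?thesis using ss by (auto simp: sign_lists_def)
  qed
  then show "(\<lambda>j\<in>{1..M}. ss ! (j - 1)) \<in> {1..M} \<rightarrow>\<^sub>E {1, - 1}"
    by (subst restrict_PiE_iff) blast
qed simp

text \<open>The recursion collects pairs by their smaller index, the closed form by the larger one;
  \<open>tail\<close> regroups them.\<close>

lemma sign_coeff_map_upt: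
  "sign_coeff \<eta> \<xi> N (map u [a..<b]) = (\<Prod>j\<in>{a..<b}. a_fun N \<eta> \<xi> (- u j) / sinh (2 * u j)) *
     (\<Prod>j\<in>{a..<b}. \<Prod>i\<in>{a..<j}. sinh (u i + u j + \<eta>) / sinh (u i + u j))"
proof (induction "b - a" arbitrary: a)
  case (Suc n)
  let ?r = "\<lambda>i j. sinh (u i + u j + \<eta>) / sinh (u i + u j)"
  have ab: "[a..<b] = a # [Suc a..<b]" "{a..<b} = insert a {Suc a..<b}"
    using Suc.hyps(2) by (auto simp: upt_conv_Cons)
  have head: "(\<Prod>i<length (map u [Suc a..<b]). sinh (u a + map u [Suc a..<b] ! i + \<eta>) /
      sinh (u a + map u [Suc a..<b] ! i)) = (\<Prod>j\<in>{Suc a..<b}. ?r a j)"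
    by (rule prod.reindex_bij_witness [where i = "\<lambda>j. j - Suc a" and j = "\<lambda>i. Suc a + i"]) auto
  have tail: "(\<Prod>j\<in>{Suc a..<b}. \<Prod>i\<in>{a..<j}. ?r i j) =
      (\<Prod>j\<in>{Suc a..<b}. ?r a j * (\<Prod>i\<in>{Suc a..<j}. ?r i j))"
  proof (rule prod.cong [OF refl])
    fix j assume "j \<in> {Suc a..<b}"
    then have "{a..<j} = insert a {Suc a..<j}" by auto
    then show "(\<Prod>i\<in>{a..<j}. ?r i j) = ?r a j * (\<Prod>i\<in>{Suc a..<j}. ?r i j)" by simp
  qed
  have IH: "sign_coeff \<eta> \<xi> N (map u [Suc a..<b]) =
     (\<Prod>j\<in>{Suc a..<b}. a_fun N \<eta> \<xi> (- u j) / sinh (2 * u j)) *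
     (\<Prod>j\<in>{Suc a..<b}. \<Prod>i\<in>{Suc a..<j}. ?r i j)"
    using Suc.hyps(2) by (intro Suc.hyps(1)) simp
  have "(\<Prod>j\<in>insert a {Suc a..<b}. a_fun N \<eta> \<xi> (- u j) / sinh (2 * u j)) =
      a_fun N \<eta> \<xi> (- u a) / sinh (2 * u a) * (\<Prod>j\<in>{Suc a..<b}. a_fun N \<eta> \<xi> (- u j) / sinh (2 * u j))"
    "(\<Prod>j\<in>insert a {Suc a..<b}. \<Prod>i\<in>{a..<j}. ?r i j) = (\<Prod>j\<in>{Suc a..<b}. \<Prod>i\<in>{a..<j}. ?r i j)"
    by simp_all
  then show ?case
    unfolding ab list.map sign_coeff.simps head IH tail prod.distrib by (simp only: mult_ac)
qed simp

lemma H_coeff_sign_coeff: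
  assumes "\<sigma> \<in> {1..M} \<rightarrow>\<^sub>E {1, - 1}"
  shows "H_coeff N \<eta> \<xi> M \<sigma> \<mu> = (\<Prod>l\<leftarrow>map \<mu> [1..<M + 1]. sinh (2 * l - \<eta>)) *
    sign_coeff \<eta> \<xi> N (map (\<lambda>j. \<sigma> j * \<mu> j) [1..<M + 1])"
proof -
  have factor: "\<sigma> j * a_fun N \<eta> \<xi> (- (\<sigma> j * \<mu> j)) * (sinh (2 * \<mu> j - \<eta>) / sinh (2 * \<mu> j)) =
      sinh (2 * \<mu> j - \<eta>) * (a_fun N \<eta> \<xi> (- (\<sigma> j * \<mu> j)) / sinh (2 * (\<sigma> j * \<mu> j)))"
    if "j \<in> {1..M}" for j
  proof -
    have "\<sigma> j = 1 \<or> \<sigma> j = - 1" using assms that by (auto simp: PiE_iff)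
    then show ?thesis by auto
  qed
  have "(\<Prod>l\<leftarrow>map \<mu> [1..<M + 1]. sinh (2 * l - \<eta>)) = (\<Prod>j\<in>{1..<M + 1}. sinh (2 * \<mu> j - \<eta>))"
    using prod.distinct_set_conv_list [of "[1..<M + 1]" "\<lambda>j. sinh (2 * \<mu> j - \<eta>)"]
    by (simp add: comp_def del: upt_Suc)
  moreover have "{1..<M + 1} = {1..M}" by auto
  moreover have "(\<Prod>j\<in>{1..M}. \<sigma> j * a_fun N \<eta> \<xi> (- (\<sigma> j * \<mu> j)) * (sinh (2 * \<mu> j - \<eta>) / sinh (2 * \<mu> j))) =
      (\<Prod>j\<in>{1..M}. sinh (2 * \<mu> j - \<eta>)) *
      (\<Prod>j\<in>{1..M}. a_fun N \<eta> \<xi> (- (\<sigma> j * \<mu> j)) / sinh (2 * (\<sigma> j * \<mu> j)))"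
    unfolding prod.distrib [symmetric] by (rule prod.cong [OF refl factor])
  ultimately show ?thesis
    unfolding H_coeff_def sign_coeff_map_upt by (simp only: mult.assoc)
qed

text \<open>The numerators depend on z and shift with it, so the first of them is split off and z is
  raised by 2. The denominators do not involve z, hence the last of them is split off.\<close>

lemma h_coeff_Suc:
  "h_coeff N \<eta> (Suc M) x z y = (- 1) ^ N * exp (\<eta> * (x + z + of_nat N) / 2 - of_nat M * \<eta>) *
     (sinh (\<eta> * ((z - y + of_nat N + 1) / 2)) / (2 * sinh (\<eta> * ((y - x + 2 * of_nat (Suc M)) / 2)))) *
     h_coeff N \<eta> M x (z + 2) y"
proof -
  let ?s = "\<lambda>z j. sinh (\<eta> * ((z - y + 2 * of_nat j + of_nat N - 1) / 2))"
  let ?d = "\<lambda>j. 2 * sinh (\<eta> * ((y - x + 2 * of_nat j) / 2))"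
  have head: "(\<Prod>j\<in>{1..Suc M}. ?s z j) = ?s z 1 * (\<Prod>j\<in>{1..M}. ?s z (Suc j))"
  proof -
    have "{1..Suc M} = insert 1 (Suc ` {1..M})" by (auto simp: image_Suc_atLeastAtMost)
    then show ?thesis
      by (simp only:, subst prod.insert) (auto simp: prod.reindex simp del: of_nat_Suc image_Suc_atLeastAtMost)
  qed
  have shift: "?s z (Suc j) = ?s (z + 2) j" for j
    by (rule arg_cong [where f = sinh]) (simp add: algebra_simps)
  have num: "(\<Prod>j\<in>{1..Suc M}. ?s z j) = ?s z 1 * (\<Prod>j\<in>{1..M}. ?s (z + 2) j)"
    unfolding head shift ..
  have s1: "?s z 1 = sinh (\<eta> * ((z - y + of_nat N + 1) / 2))"
    by (rule arg_cong [where f = sinh]) (simp add: algebra_simps)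
  have ex: "exp (of_nat (Suc M) * \<eta> * ((x + z + of_nat N) / 2)) =
      exp (\<eta> * (x + z + of_nat N) / 2 - of_nat M * \<eta>) * exp (of_nat M * \<eta> * ((x + (z + 2) + of_nat N) / 2))"
    unfolding mult_exp_exp by (rule arg_cong [where f = exp]) (simp add: field_simps)
  have den: "(\<Prod>j\<in>{1..Suc M}. ?d j) = (\<Prod>j\<in>{1..M}. ?d j) * ?d (Suc M)"
    by (simp del: of_nat_Suc)
  have sg: "(- 1 :: complex) ^ (Suc M * N) = (- 1) ^ N * (- 1) ^ (M * N)"
    by (simp add: power_add)
  have regroup: "s * s' * (e * e') * (a * p / (d * b)) = s * e * (a / b) * (s' * e' * (p / d))"
    for s s' e e' a p d b :: complex
    by (simp add: mult_ac)
  show ?thesis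
    unfolding h_coeff_def prod_dividef num den ex s1 sg regroup ..
qed

text \<open>Each factor is a quotient of differences of exponentials. Splitting off the mean
  exponents leaves the two sinh factors, and the mean exponents combine with 1 / q into the
  exponential in \<open>h_coeff_Suc\<close>.\<close>

lemma gauge_coeff_h_coeff:
  "gauge_coeff \<eta> N (exp (\<eta> * (of_nat N - y))) (exp (\<eta> / 2 - \<eta> * x)) (exp (- \<eta> * y - \<eta> / 2)) M
     (exp (- \<eta> / 2 - \<eta> * z)) = h_coeff N \<eta> M x z y"
proof (induction M arbitrary: z)
  case 0
  show ?case by (simp add: h_coeff_def)
next
  case (Suc M)
  define q where "q = exp (- \<eta> / 2 - \<eta> * z)"
  have pow: "exp \<eta> ^ k = exp (of_nat k * \<eta>)" "exp (- \<eta>) ^ k = exp (- (of_nat k * \<eta>))" for k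
    by (simp_all flip: exp_of_nat_mult)
  have q': "q * exp (- \<eta>) * exp (- \<eta>) = exp (- \<eta> / 2 - \<eta> * (z + 2))"
    unfolding q_def mult_exp_exp by (rule arg_cong [where f = exp]) (simp add: algebra_simps)
  have iq: "1 / q = exp (\<eta> / 2 + \<eta> * z)"
  proof -
    have "q * exp (\<eta> / 2 + \<eta> * z) = 1" unfolding q_def mult_exp_exp by simp
    then show ?thesis by (metis mult_zero_left nonzero_mult_div_cancel_left one_neq_zero)
  qed
  let ?a = "\<eta> * (of_nat N - y) - of_nat M * \<eta> - \<eta> / 2" and ?b = "- \<eta> / 2 - \<eta> * z - \<eta> - of_nat M * \<eta>"
  let ?c = "\<eta> / 2 - \<eta> * x + of_nat M * \<eta>" and ?d = "- \<eta> * y - \<eta> / 2 - of_nat (Suc M) * \<eta>"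
  have num: "exp (\<eta> * (of_nat N - y)) * exp (- \<eta>) ^ M * exp (- \<eta> / 2) - q * exp (- \<eta>) * exp (- \<eta>) ^ M =
      2 * exp ((?a + ?b) / 2) * sinh (\<eta> * ((z - y + of_nat N + 1) / 2))"
  proof -
    have eqs: "exp (\<eta> * (of_nat N - y)) * exp (- \<eta>) ^ M * exp (- \<eta> / 2) = exp ?a"
      "q * exp (- \<eta>) * exp (- \<eta>) ^ M = exp ?b"
      unfolding q_def pow mult_exp_exp by (rule arg_cong [where f = exp], simp add: algebra_simps)+
    have arg: "(?a - ?b) / 2 = \<eta> * ((z - y + of_nat N + 1) / 2)"
      by (simp add: field_simps)
    show ?thesis unfolding eqs exp_minus_exp_sinh [of ?a ?b] arg ..
  qed
  have den: "exp (\<eta> / 2 - \<eta> * x) * exp \<eta> ^ M - exp (- \<eta> * y - \<eta> / 2) * exp (- \<eta>) ^ Suc M =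
      2 * exp ((?c + ?d) / 2) * sinh (\<eta> * ((y - x + 2 * of_nat (Suc M)) / 2))"
  proof -
    have eqs: "exp (\<eta> / 2 - \<eta> * x) * exp \<eta> ^ M = exp ?c"
      "exp (- \<eta> * y - \<eta> / 2) * exp (- \<eta>) ^ Suc M = exp ?d"
      unfolding pow mult_exp_exp by (rule arg_cong [where f = exp], simp add: algebra_simps)+
    have arg: "(?c - ?d) / 2 = \<eta> * ((y - x + 2 * of_nat (Suc M)) / 2)"
      by (simp add: field_simps)
    show ?thesis unfolding eqs exp_minus_exp_sinh [of ?c ?d] arg ..
  qed
  have ex: "exp (\<eta> * (x + z + of_nat N) / 2 - of_nat M * \<eta>) = 1 / q * exp ((?a + ?b) / 2) / exp ((?c + ?d) / 2)"
    unfolding iq mult_exp_exp exp_diff [symmetric]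
    by (rule arg_cong [where f = exp]) (simp add: field_simps)
  have regroup: "s / (2 * q) * ((2 * e * a) / (2 * f * b)) * h = s * (1 / q * e / f) * (a / (2 * b)) * h"
    for s e f a b h :: complex
    by (simp add: mult_ac)
  show ?case
    unfolding gauge_coeff.simps q_def [symmetric] q' Suc.IH num den h_coeff_Suc ex regroup ..
qed

text \<open>The nonvanishing conditions concern the denominators of H for all signs, where opposite
  signs turn \<mu>_i + \<mu>_j into a difference, and those of h. Sign choices are extensional
  functions, so each one is counted once.\<close>

theorem propositionB1:
  fixes N M :: nat and \<eta> x y z :: complex and \<xi> \<mu> :: "nat \<Rightarrow> complex"
  assumes "N \<ge> 1" and "sinh \<eta> \<noteq> 0"
    and "\<And>j. 1 \<le> j \<Longrightarrow> j \<le> M \<Longrightarrow> sinh (2 * \<mu> j) \<noteq> 0"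
    and "\<And>i j. 1 \<le> i \<Longrightarrow> i < j \<Longrightarrow> j \<le> M \<Longrightarrow> sinh (\<mu> i + \<mu> j) \<noteq> 0 \<and> sinh (\<mu> i - \<mu> j) \<noteq> 0"
    and "\<And>j. 1 \<le> j \<Longrightarrow> j \<le> M \<Longrightarrow> sinh (\<eta> * ((y - x + 2 * of_nat j) / 2)) \<noteq> 0"
  shows "B_hat_prod N \<eta> \<xi> M \<mu> (z + 1) *\<^sub>v ref_state N \<eta> \<xi> y =
    h_coeff N \<eta> M x z y \<cdot>\<^sub>v
      finsum_vec TYPE(complex) (2 ^ N)
        (\<lambda>\<sigma>. H_coeff N \<eta> \<xi> M \<sigma> \<mu> \<cdot>\<^sub>v
           (B_bulk_prod N \<eta> \<xi> M (\<lambda>j. \<sigma> j * \<mu> j) (x - 1) z *\<^sub>v ref_state N \<eta> \<xi> (y + of_nat M)))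
        ({1..M} \<rightarrow>\<^sub>E {1, - 1})"
proof -
  \<comment> \<open>p and q encode the initial gauge parameters x - 1 and z of the bulk string. s is
    the row parameter that belongs to y, for which the diagonal operator maps the reference state to
    a multiple of a shifted one.\<close>
  define Q p s q where "Q = exp (\<eta> * (of_nat N - y))" and "p = exp (\<eta> / 2 - \<eta> * x)"
    and "s = exp (- \<eta> * y - \<eta> / 2)" and "q = exp (- \<eta> / 2 - \<eta> * z)"
  define ls where "ls = map \<mu> [1..<M + 1]"
  let ?\<Omega> = "product_state \<eta> \<xi> N (Q * exp (- \<eta>) ^ M)"
  let ?G = "\<lambda>us. gauge_B_list \<eta> \<xi> N us p q ?\<Omega>"
  have len: "length ls = M" by (simp add: ls_def)
  have Q': "exp (\<eta> * (of_nat N - (y + of_nat M))) = Q * exp (- \<eta>) ^ M"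
    unfolding Q_def exp_of_nat_mult [symmetric] mult_exp_exp
    by (rule arg_cong [where f = exp]) (simp add: algebra_simps)
  have s: "s = Q * exp (- (of_nat N * \<eta> + \<eta> / 2))"
    unfolding Q_def s_def mult_exp_exp by (rule arg_cong [where f = exp]) (simp add: algebra_simps)
  have expansion: "boundary_B_list \<eta> \<xi> N ls q (product_state \<eta> \<xi> N Q) c =
      h_coeff N \<eta> M x z y * (\<Prod>l\<leftarrow>ls. sinh (2 * l - \<eta>)) *
      (\<Sum>ss\<in>sign_lists M. sign_coeff \<eta> \<xi> N (map2 (*) ss ls) * ?G (map2 (*) ss ls) c)" for c
  proof -
    have nz: "sinh (2 * l) \<noteq> 0" if "l \<in> set ls" for l
      using that assms(3) by (auto simp: ls_def simp del: upt_Suc)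
    have pairs: "sorted_wrt (\<lambda>l m. sinh (l + m) \<noteq> 0 \<and> sinh (l - m) \<noteq> 0) ls"
      using assms(4) by (auto simp: ls_def sorted_wrt_iff_nth_less simp del: upt_Suc)
    \<comment> \<open>The index k counts from 0 and the denominators of h from 1, so k corresponds
      to j = k + 1.\<close>
    have gauge: "p * exp \<eta> ^ k \<noteq> s * exp (- \<eta>) ^ Suc k" if "k < length ls" for k
    proof -
      let ?a = "\<eta> / 2 - \<eta> * x + of_nat k * \<eta>" and ?b = "- \<eta> * y - \<eta> / 2 + of_nat (Suc k) * - \<eta>"
      have eqs: "p * exp \<eta> ^ k = exp ?a" "s * exp (- \<eta>) ^ Suc k = exp ?b"
        unfolding p_def s_def exp_of_nat_mult [symmetric] mult_exp_exp by (rule refl)+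
      have arg: "(?a - ?b) / 2 = \<eta> * ((y - x + 2 * of_nat (Suc k)) / 2)"
        by (simp add: field_simps)
      have "p * exp \<eta> ^ k - s * exp (- \<eta>) ^ Suc k =
          2 * exp ((?a + ?b) / 2) * sinh (\<eta> * ((y - x + 2 * of_nat (Suc k)) / 2))"
        unfolding eqs exp_minus_exp_sinh [of ?a ?b] arg ..
      moreover have "sinh (\<eta> * ((y - x + 2 * of_nat (Suc k)) / 2)) \<noteq> 0"
        using that len by (intro assms(5)) auto
      ultimately show ?thesis by (metis diff_self divisors_zero exp_not_eq_zero zero_neq_numeral)
    qed
    have "gauge_coeff \<eta> N Q p s M q = h_coeff N \<eta> M x z y"
      unfolding Q_def p_def s_def q_def by (rule gauge_coeff_h_coeff)
    then show ?thesis
      using boundary_B_list_expansion [OF nz pairs gauge s, of \<xi> q c]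
      by (simp add: len)
  qed
  have w: "exp (\<eta> / 2 - \<eta> * (z + 1)) = q" "exp (- \<eta> / 2 - \<eta> * (x - 1)) = p"
    unfolding p_def q_def by (rule arg_cong [where f = exp], simp add: algebra_simps)+
  have bulk: "B_bulk_prod N \<eta> \<xi> M (\<lambda>j. \<sigma> j * \<mu> j) (x - 1) z *\<^sub>v ref_state N \<eta> \<xi> (y + of_nat M) =
      state_vec N (?G (map2 (*) (map \<sigma> [1..<M + 1]) ls))" for \<sigma>
    unfolding ref_state_product_state B_bulk_prod_state_vec Q' w ls_def map2_map_map q_def ..
  define W where "W \<sigma> = H_coeff N \<eta> \<xi> M \<sigma> \<mu> \<cdot>\<^sub>v state_vec N (?G (map2 (*) (map \<sigma> [1..<M + 1]) ls))" for \<sigma>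
  have W: "W \<in> ({1..M} \<rightarrow>\<^sub>E {1, - 1}) \<rightarrow> carrier_vec (2 ^ N)"
    by (simp add: W_def)
  have finite: "finite ({1..M} \<rightarrow>\<^sub>E {1, - 1 :: complex})"
    by (intro finite_PiE) simp_all
  have "B_hat_prod N \<eta> \<xi> M \<mu> (z + 1) *\<^sub>v ref_state N \<eta> \<xi> y =
      h_coeff N \<eta> M x z y \<cdot>\<^sub>v finsum_vec TYPE(complex) (2 ^ N) W ({1..M} \<rightarrow>\<^sub>E {1, - 1})"
    (is "_ = _ \<cdot>\<^sub>v ?V")
  proof -
    have V: "?V \<in> carrier_vec (2 ^ N)" by (rule finsum_vec_closed [OF W])
    have "B_hat_prod N \<eta> \<xi> M \<mu> (z + 1) *\<^sub>v ref_state N \<eta> \<xi> y =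
        state_vec N (boundary_B_list \<eta> \<xi> N ls q (product_state \<eta> \<xi> N Q))"
      unfolding ref_state_product_state B_hat_prod_state_vec w Q_def [symmetric] ls_def ..
    also have "\<dots> = h_coeff N \<eta> M x z y \<cdot>\<^sub>v ?V"
    proof (rule eq_vecI)
      fix k assume "k < dim_vec (h_coeff N \<eta> M x z y \<cdot>\<^sub>v ?V)"
      then have k: "k < 2 ^ N" using V by simp
      have "boundary_B_list \<eta> \<xi> N ls q (product_state \<eta> \<xi> N Q) (bit k) =
        h_coeff N \<eta> M x z y * (\<Sum>\<sigma>\<in>{1..M} \<rightarrow>\<^sub>E {1, - 1}. H_coeff N \<eta> \<xi> M \<sigma> \<mu> *
          ?G (map2 (*) (map \<sigma> [1..<M + 1]) ls) (bit k))"
        unfolding expansion sum_PiE_sign_lists [symmetric] mult.assoc sum_distrib_left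
        by (intro sum.cong refl) (simp only: H_coeff_sign_coeff ls_def map2_map_map mult.assoc)
      then show "state_vec N (boundary_B_list \<eta> \<xi> N ls q (product_state \<eta> \<xi> N Q)) $ k =
          (h_coeff N \<eta> M x z y \<cdot>\<^sub>v ?V) $ k"
        using k V index_finsum_vec [OF finite k W] by (simp add: W_def state_vec_def del: upt_Suc)
    qed (use V in \<open>simp add: state_vec_def\<close>)
    finally show ?thesis .
  qed
  then show ?thesis unfolding bulk W_def .
qed

end
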